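(* (i) Let $f\colon (A,T)\to (B,P)$ be a morphism of p-multirings. Then there exists a unique multiring morphism $Q(f)\colon Q_T(A)\to Q_P(B)$ such that $Q(f)\circ \pi_{(A,T)}=\pi_{(B,P)}\circ f$. Furthermore, $(A,T)\mapsto Q_T(A)$, $f\mapsto Q(f)$ defines a functor $Q$ from the category $\mathbf{pMulti}$ to the category $\mathbf{RRM}$. (ii) Let $(A,T)$ be a p-multiring, let $R$ be a real reduced multiring, and let $f\colon (A,T)\to (R,\sum R^2)$ be a morphism of p-multirings. Then there exists a unique multiring morphism $\overline f\colon Q_T(A)\to R$ such that $\overline f\circ\pi_{(A,T)}=f$. In other words, the functor $Q\colon \mathbf{pMulti}\to\mathbf{RRM}$ is left adjoint to the inclusion functor $i\colon\mathbf{RRM}\to\mathbf{pMulti}$ given by $i(R)=(R,\sum R^2)$.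
   Context: A multiring is a tuple $(A,+,-,\cdot,0,1)$ where $(A,\cdot,1)$ is a commutative monoid, $+\colon A\times A\to\{\text{nonempty subsets of }A\}$ and $-\colon A\to A$ are functions and $0\in A$, such that for all $a,b,c,d\in A$: (1) $a\in b+c$ implies $c\in -b+a$ and $b\in a+(-c)$; (2) $a\in b+0$ iff $a=b$; (3) if $x\in g+c$ with $g\in a+b$, then there is $h\in b+c$ with $x\in a+h$; (4) $a+b=b+a$; (5) $a\cdot 0=0$; (6) $a\in b+c$ implies $ad\in bd+cd$. For subsets, $X+Y=\bigcup_{x\in X,y\in Y}x+y$ and $X\cdot Y=\{xy: x\in X, y\in Y\}$; iterated sums are defined accordingly. A morphism of multirings $f\colon A\to B$ is a map with $f(a)\in f(b)+f(c)$ whenever $a\in b+c$, $f(ab)=f(a)f(b)$, $f(0)=0$, $f(1)=1$, $f(-a)=-f(a)$. The multiring $\mathbf 3=\{-1,0,1\}$ has the usual multiplication and negation, and sum $0+x=x+0=\{x\}$, $1+1=\{1\}$, $(-1)+(-1)=\{-1\}$, $1+(-1)=(-1)+1=\{-1,0,1\}$. $\mathrm{sper}(A)$ is the set of multiring morphisms $A\to\mathbf 3$. $A^2=\{x^2:x\in A\}$ and $\sum A^2=\bigcup_{n\ge1}\{x_1^2+\cdots+x_n^2 : x_i\in A\}$ (union of these subsets of $A$). A preorder of $A$ is a subset $T\subseteq A$ with $A^2\subseteq T$, $T\cdot T\subseteq T$, $T+T\subseteq T$; it is proper if $-1\notin T$. A p-multiring is a pair $(A,T)$ with $A$ a multiring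 and $T$ a proper preorder of $A$. A morphism of p-multirings $(A,T)\to(B,P)$ is a multiring morphism $f\colon A\to B$ with $f(T)\subseteq P$. $\mathbf{pMulti}$ is the category of p-multirings. For a p-multiring $(A,T)$, $\mathrm{sper}_T(A)=\{\sigma\in\mathrm{sper}(A):\sigma(T)\subseteq\{0,1\}\}$. For $a\in A$ let $\hat a\in\mathbf 3^{\mathrm{sper}_T(A)}$, $\hat a(\sigma)=\sigma(a)$. $Q_T(A)=\{\hat a: a\in A\}$ with $\hat a\hat b=\widehat{ab}$, $-\hat a=\widehat{-a}$, constants $\hat 0,\hat 1$, and $\hat a\in\hat b+\hat c$ iff there are $a',b',c'\in A$ with $\hat a'=\hat a$, $\hat b'=\hat b$, $\hat c'=\hat c$ and $a'\in b'+c'$. The map $\pi_{(A,T)}\colon A\to Q_T(A)$ is $a\mapsto\hat a$. It is known that $Q_T(A)$ is a real reduced multiring. A multiring $A$ is semi-real if $-1\notin\sum A^2$. A real reduced multiring is a semi-real multiring $A$ such that for all $a,b\in A$: $a^3=a$; $a+b^2a=\{a\}$; $a^2+b^2$ has exactly one element. $\mathbf{RRM}$ is the category of real reduced multirings with multiring morphisms. For $R$ real reduced, $(R,\sum R^2)$ is a p-multiring. *)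

theory Defs
  imports "HOL-Algebra.Group" "HOL-Library.FuncSet"
begin

section \<open>Multirings\<close>

record 'a multiring = "'a monoid" +
  mzero :: 'a ("\<zero>\<index>")
  madd :: "['a, 'a] \<Rightarrow> 'a set" (infixl "\<oplus>\<index>" 65)
  mneg :: "'a \<Rightarrow> 'a" ("\<ominus>\<index> _" [81] 80)

locale multiring = comm_monoid A for A :: "'a multiring" (structure) +
  assumes zero_closed: "\<zero> \<in> carrier A"
    and neg_closed: "a \<in> carrier A \<Longrightarrow> \<ominus> a \<in> carrier A"
    and add_closed: "\<lbrakk>a \<in> carrier A; b \<in> carrier A\<rbrakk> \<Longrightarrow> a \<oplus> b \<subseteq> carrier A"
    and add_nonempty: "\<lbrakk>a \<in> carrier A; b \<in> carrier A\<rbrakk> \<Longrightarrow> a \<oplus> b \<noteq> {}"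
    and add_rev:
      "\<lbrakk>a \<in> carrier A; b \<in> carrier A; c \<in> carrier A; a \<in> b \<oplus> c\<rbrakk>
        \<Longrightarrow> c \<in> (\<ominus> b) \<oplus> a \<and> b \<in> a \<oplus> (\<ominus> c)"
    and add_zero:
      "\<lbrakk>a \<in> carrier A; b \<in> carrier A\<rbrakk> \<Longrightarrow> a \<in> b \<oplus> \<zero> \<longleftrightarrow> a = b"
    and add_assoc:
      "\<lbrakk>a \<in> carrier A; b \<in> carrier A; c \<in> carrier A; g \<in> a \<oplus> b; x \<in> g \<oplus> c\<rbrakk>
        \<Longrightarrow> \<exists>h\<in>b \<oplus> c. x \<in> a \<oplus> h"
    and add_comm: "\<lbrakk>a \<in> carrier A; b \<in> carrier A\<rbrakk> \<Longrightarrow> a \<oplus> b = b \<oplus> a"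
    and mult_zero: "a \<in> carrier A \<Longrightarrow> a \<otimes> \<zero> = \<zero>"
    and distrib:
      "\<lbrakk>a \<in> carrier A; b \<in> carrier A; c \<in> carrier A; d \<in> carrier A; a \<in> b \<oplus> c\<rbrakk>
        \<Longrightarrow> a \<otimes> d \<in> (b \<otimes> d) \<oplus> (c \<otimes> d)"

text \<open>Morphisms are extensional functions (undefined off the carrier), so that equality
  of HOL functions is equality of maps between the carriers.\<close>

definition multi_hom :: "'a multiring \<Rightarrow> 'b multiring \<Rightarrow> ('a \<Rightarrow> 'b) set" where
  "multi_hom A B = {f \<in> carrier A \<rightarrow>\<^sub>E carrier B.
     (\<forall>a\<in>carrier A. \<forall>b\<in>carrier A. \<forall>c\<in>carrier A.
        a \<in> b \<oplus>\<^bsub>A\<^esub> c \<longrightarrow> f a \<in> f b \<oplus>\<^bsub>B\<^esub> f c) \<and>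
     (\<forall>a\<in>carrier A. \<forall>b\<in>carrier A. f (a \<otimes>\<^bsub>A\<^esub> b) = f a \<otimes>\<^bsub>B\<^esub> f b) \<and>
     f \<zero>\<^bsub>A\<^esub> = \<zero>\<^bsub>B\<^esub> \<and> f \<one>\<^bsub>A\<^esub> = \<one>\<^bsub>B\<^esub> \<and>
     (\<forall>a\<in>carrier A. f (\<ominus>\<^bsub>A\<^esub> a) = \<ominus>\<^bsub>B\<^esub> f a)}"

definition three :: "int multiring" where
  "three = \<lparr>carrier = {-1, 0, 1}, mult = (*), one = 1, mzero = 0,
     madd = (\<lambda>x y. if x = 0 then {y} else if y = 0 then {x}
                    else if x = y then {x} else {-1, 0, 1}),
     mneg = uminus\<rparr>"

definition sper :: "'a multiring \<Rightarrow> ('a \<Rightarrow> int) set" where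
  "sper A = multi_hom A three"

definition set_sum :: "'a multiring \<Rightarrow> 'a set \<Rightarrow> 'a set \<Rightarrow> 'a set" where
  "set_sum A X Y = (\<Union>x\<in>X. \<Union>y\<in>Y. x \<oplus>\<^bsub>A\<^esub> y)"

definition set_prod :: "'a multiring \<Rightarrow> 'a set \<Rightarrow> 'a set \<Rightarrow> 'a set" where
  "set_prod A X Y = {x \<otimes>\<^bsub>A\<^esub> y | x y. x \<in> X \<and> y \<in> Y}"

fun iter_sum :: "'a multiring \<Rightarrow> 'a list \<Rightarrow> 'a set" where
  "iter_sum A [] = {\<zero>\<^bsub>A\<^esub>}"
| "iter_sum A [x] = {x}"
| "iter_sum A (x # y # ys) = set_sum A {x} (iter_sum A (y # ys))"

definition squares :: "'a multiring \<Rightarrow> 'a set" where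
  "squares A = {x [^]\<^bsub>A\<^esub> (2::nat) | x. x \<in> carrier A}"

definition sum_squares :: "'a multiring \<Rightarrow> 'a set" where
  "sum_squares A =
     (\<Union>xs\<in>{xs. xs \<noteq> [] \<and> set xs \<subseteq> carrier A}. iter_sum A (map (\<lambda>x. x [^]\<^bsub>A\<^esub> (2::nat)) xs))"

definition preorder_of :: "'a multiring \<Rightarrow> 'a set \<Rightarrow> bool" where
  "preorder_of A T \<longleftrightarrow> T \<subseteq> carrier A \<and> squares A \<subseteq> T \<and> set_prod A T T \<subseteq> T \<and> set_sum A T T \<subseteq> T"

definition p_multiring :: "'a multiring \<Rightarrow> 'a set \<Rightarrow> bool" where
  "p_multiring A T \<longleftrightarrow> multiring A \<and> preorder_of A T \<and> \<ominus>\<^bsub>A\<^esub> \<one>\<^bsub>A\<^esub> \<notin> T"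

definition p_hom :: "'a multiring \<Rightarrow> 'a set \<Rightarrow> 'b multiring \<Rightarrow> 'b set \<Rightarrow> ('a \<Rightarrow> 'b) set" where
  "p_hom A T B P = {f \<in> multi_hom A B. f ` T \<subseteq> P}"

definition real_reduced :: "'a multiring \<Rightarrow> bool" where
  "real_reduced A \<longleftrightarrow> multiring A \<and> \<ominus>\<^bsub>A\<^esub> \<one>\<^bsub>A\<^esub> \<notin> sum_squares A \<and>
     (\<forall>a\<in>carrier A. a [^]\<^bsub>A\<^esub> (3::nat) = a) \<and>
     (\<forall>a\<in>carrier A. \<forall>b\<in>carrier A. a \<oplus>\<^bsub>A\<^esub> (b [^]\<^bsub>A\<^esub> (2::nat) \<otimes>\<^bsub>A\<^esub> a) = {a}) \<and>
     (\<forall>a\<in>carrier A. \<forall>b\<in>carrier A. \<exists>x. (a [^]\<^bsub>A\<^esub> (2::nat)) \<oplus>\<^bsub>A\<^esub> (b [^]\<^bsub>A\<^esub> (2::nat)) = {x})"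


section \<open>The real reduced multiring of a p-multiring\<close>

definition sper_T :: "'a multiring \<Rightarrow> 'a set \<Rightarrow> ('a \<Rightarrow> int) set" where
  "sper_T A T = {\<sigma> \<in> sper A. \<sigma> ` T \<subseteq> {0, 1}}"

definition hat :: "'a multiring \<Rightarrow> 'a set \<Rightarrow> 'a \<Rightarrow> (('a \<Rightarrow> int) \<Rightarrow> int)" where
  "hat A T a = (\<lambda>\<sigma>\<in>sper_T A T. \<sigma> a)"

text \<open>Product and negation are those of the power of \<open>three\<close>; the lemmas \<open>Q_mult_hat\<close> and
  \<open>Q_neg_hat\<close> below show that on \<open>hat\<close>s they are induced by the operations of \<open>A\<close>.\<close>

definition Q :: "'a multiring \<Rightarrow> 'a set \<Rightarrow> (('a \<Rightarrow> int) \<Rightarrow> int) multiring" where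
  "Q A T = \<lparr>carrier = hat A T ` carrier A,
     mult = (\<lambda>\<phi> \<psi>. \<lambda>\<sigma>\<in>sper_T A T. \<phi> \<sigma> \<otimes>\<^bsub>three\<^esub> \<psi> \<sigma>),
     one = hat A T \<one>\<^bsub>A\<^esub>,
     mzero = hat A T \<zero>\<^bsub>A\<^esub>,
     madd = (\<lambda>\<phi> \<psi>. {\<chi>. \<exists>a\<in>carrier A. \<exists>b\<in>carrier A. \<exists>c\<in>carrier A.
        hat A T a = \<chi> \<and> hat A T b = \<phi> \<and> hat A T c = \<psi> \<and> a \<in> b \<oplus>\<^bsub>A\<^esub> c}),
     mneg = (\<lambda>\<phi>. \<lambda>\<sigma>\<in>sper_T A T. \<ominus>\<^bsub>three\<^esub> \<phi> \<sigma>)\<rparr>"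

lemma Q_mult_hat:
  assumes "a \<in> carrier A" "b \<in> carrier A"
  shows "hat A T a \<otimes>\<^bsub>Q A T\<^esub> hat A T b = hat A T (a \<otimes>\<^bsub>A\<^esub> b)"
  using assms by (auto simp: Q_def hat_def sper_T_def sper_def multi_hom_def intro!: restrict_ext)

lemma Q_neg_hat:
  assumes "a \<in> carrier A"
  shows "\<ominus>\<^bsub>Q A T\<^esub> hat A T a = hat A T (\<ominus>\<^bsub>A\<^esub> a)"
  using assms by (auto simp: Q_def hat_def sper_T_def sper_def multi_hom_def intro!: restrict_ext)

definition proj :: "'a multiring \<Rightarrow> 'a set \<Rightarrow> 'a \<Rightarrow> (('a \<Rightarrow> int) \<Rightarrow> int)" where
  "proj A T = (\<lambda>a\<in>carrier A. hat A T a)"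

definition Q_map :: "'a multiring \<Rightarrow> 'a set \<Rightarrow> 'b multiring \<Rightarrow> 'b set \<Rightarrow> ('a \<Rightarrow> 'b)
    \<Rightarrow> (('a \<Rightarrow> int) \<Rightarrow> int) \<Rightarrow> (('b \<Rightarrow> int) \<Rightarrow> int)" where
  "Q_map A T B P f = (THE g. g \<in> multi_hom (Q A T) (Q B P) \<and>
     compose (carrier A) g (proj A T) = compose (carrier A) (proj B P) f)"


section \<open>Categories, functors, adjunctions\<close>

text \<open>Categories are given by hom-sets, which need not be disjoint; hence composition and
  the action of a functor on morphisms take the objects involved as arguments.
  \<open>Comp C x y z g f\<close> is the composite of \<open>f\<close> from \<open>x\<close> to \<open>y\<close> with \<open>g\<close> from \<open>y\<close> to \<open>z\<close>.\<close>

record ('o, 'm) cat =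
  Ob :: "'o set"
  Hom :: "'o \<Rightarrow> 'o \<Rightarrow> 'm set"
  Id :: "'o \<Rightarrow> 'm"
  Comp :: "'o \<Rightarrow> 'o \<Rightarrow> 'o \<Rightarrow> 'm \<Rightarrow> 'm \<Rightarrow> 'm"

locale category =
  fixes C :: "('o, 'm) cat"
  assumes Id_in: "x \<in> Ob C \<Longrightarrow> Id C x \<in> Hom C x x"
    and Comp_in: "\<lbrakk>x \<in> Ob C; y \<in> Ob C; z \<in> Ob C; f \<in> Hom C x y; g \<in> Hom C y z\<rbrakk>
      \<Longrightarrow> Comp C x y z g f \<in> Hom C x z"
    and Comp_Id_left: "\<lbrakk>x \<in> Ob C; y \<in> Ob C; f \<in> Hom C x y\<rbrakk>
      \<Longrightarrow> Comp C x y y (Id C y) f = f"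
    and Comp_Id_right: "\<lbrakk>x \<in> Ob C; y \<in> Ob C; f \<in> Hom C x y\<rbrakk>
      \<Longrightarrow> Comp C x x y f (Id C x) = f"
    and Comp_assoc: "\<lbrakk>w \<in> Ob C; x \<in> Ob C; y \<in> Ob C; z \<in> Ob C;
        f \<in> Hom C w x; g \<in> Hom C x y; h \<in> Hom C y z\<rbrakk>
      \<Longrightarrow> Comp C w y z h (Comp C w x y g f) = Comp C w x z (Comp C x y z h g) f"

locale cat_functor = source: category C + target: category D
  for C :: "('o, 'm) cat" and D :: "('p, 'n) cat" +
  fixes Fo :: "'o \<Rightarrow> 'p" and Fm :: "'o \<Rightarrow> 'o \<Rightarrow> 'm \<Rightarrow> 'n"
  assumes Fo_in: "x \<in> Ob C \<Longrightarrow> Fo x \<in> Ob D"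
    and Fm_in: "\<lbrakk>x \<in> Ob C; y \<in> Ob C; f \<in> Hom C x y\<rbrakk> \<Longrightarrow> Fm x y f \<in> Hom D (Fo x) (Fo y)"
    and Fm_Id: "x \<in> Ob C \<Longrightarrow> Fm x x (Id C x) = Id D (Fo x)"
    and Fm_Comp: "\<lbrakk>x \<in> Ob C; y \<in> Ob C; z \<in> Ob C; f \<in> Hom C x y; g \<in> Hom C y z\<rbrakk>
      \<Longrightarrow> Fm x z (Comp C x y z g f) = Comp D (Fo x) (Fo y) (Fo z) (Fm y z g) (Fm x y f)"

text \<open>The functor \<open>F\<close> from \<open>C\<close> to \<open>D\<close> is left adjoint to \<open>G\<close>: there are bijections from
  \<open>Hom D (F c) d\<close> to \<open>Hom C c (G d)\<close>, natural in \<open>c\<close> and \<open>d\<close>.\<close>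

definition left_adjoint :: "('o, 'm) cat \<Rightarrow> ('p, 'n) cat
    \<Rightarrow> ('o \<Rightarrow> 'p) \<Rightarrow> ('o \<Rightarrow> 'o \<Rightarrow> 'm \<Rightarrow> 'n) \<Rightarrow> ('p \<Rightarrow> 'o) \<Rightarrow> ('p \<Rightarrow> 'p \<Rightarrow> 'n \<Rightarrow> 'm) \<Rightarrow> bool" where
  "left_adjoint C D Fo Fm Go Gm \<longleftrightarrow>
     cat_functor C D Fo Fm \<and> cat_functor D C Go Gm \<and>
     (\<exists>\<Phi>. (\<forall>c\<in>Ob C. \<forall>d\<in>Ob D. bij_betw (\<Phi> c d) (Hom D (Fo c) d) (Hom C c (Go d))) \<and>
       (\<forall>c\<in>Ob C. \<forall>c'\<in>Ob C. \<forall>d\<in>Ob D. \<forall>d'\<in>Ob D.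
         \<forall>u\<in>Hom C c' c. \<forall>v\<in>Hom D d d'. \<forall>g\<in>Hom D (Fo c) d.
           \<Phi> c' d' (Comp D (Fo c') d d' v (Comp D (Fo c') (Fo c) d g (Fm c' c u))) =
           Comp C c' (Go d) (Go d') (Gm d d' v) (Comp C c' c (Go d) (\<Phi> c d g) u)))"

definition pMulti :: "('a multiring \<times> 'a set, 'a \<Rightarrow> 'a) cat" where
  "pMulti = \<lparr>Ob = {(A, T). p_multiring A T},
     Hom = (\<lambda>(A, T) (B, P). p_hom A T B P),
     Id = (\<lambda>(A, T). \<lambda>a\<in>carrier A. a),
     Comp = (\<lambda>(A, T) _ _ g f. compose (carrier A) g f)\<rparr>"

definition RRM :: "('a multiring, 'a \<Rightarrow> 'a) cat" where
  "RRM = \<lparr>Ob = {R. real_reduced R},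
     Hom = multi_hom,
     Id = (\<lambda>R. \<lambda>a\<in>carrier R. a),
     Comp = (\<lambda>R _ _ g f. compose (carrier R) g f)\<rparr>"

definition Q_fun_ob :: "'a multiring \<times> 'a set \<Rightarrow> (('a \<Rightarrow> int) \<Rightarrow> int) multiring" where
  "Q_fun_ob = (\<lambda>(A, T). Q A T)"

definition Q_fun_map :: "'a multiring \<times> 'a set \<Rightarrow> 'a multiring \<times> 'a set \<Rightarrow> ('a \<Rightarrow> 'a)
    \<Rightarrow> (('a \<Rightarrow> int) \<Rightarrow> int) \<Rightarrow> (('a \<Rightarrow> int) \<Rightarrow> int)" where
  "Q_fun_map = (\<lambda>(A, T) (B, P). Q_map A T B P)"

definition incl_ob :: "'a multiring \<Rightarrow> 'a multiring \<times> 'a set" where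
  "incl_ob R = (R, sum_squares R)"

definition incl_map :: "'a multiring \<Rightarrow> 'a multiring \<Rightarrow> ('a \<Rightarrow> 'a) \<Rightarrow> ('a \<Rightarrow> 'a)" where
  "incl_map R S f = f"


section \<open>The functor on multirings over one type\<close>

text \<open>If \<open>A\<close> is a multiring over \<open>'a\<close> then \<open>Q A T\<close> is one over \<open>('a \<Rightarrow> int) \<Rightarrow> int\<close>. In an
  adjunction between \<open>pMulti\<close> and \<open>RRM\<close> both categories have to be taken over the same type
  of elements, so there \<open>Q A T\<close> is replaced by its isomorphic copy along an injection \<open>e A T\<close>
  of its carrier into \<open>'a\<close>. Such injections always exist (\<open>ex_relabelling\<close>), since \<open>Q A T\<close> is
  an image of \<open>A\<close>.\<close>

definition copy :: "('a \<Rightarrow> 'b) \<Rightarrow> 'a multiring \<Rightarrow> 'b multiring" where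
  "copy h M = (let k = inv_into (carrier M) h in
    \<lparr>carrier = h ` carrier M,
     mult = (\<lambda>x y. h (k x \<otimes>\<^bsub>M\<^esub> k y)),
     one = h \<one>\<^bsub>M\<^esub>,
     mzero = h \<zero>\<^bsub>M\<^esub>,
     madd = (\<lambda>x y. h ` (k x \<oplus>\<^bsub>M\<^esub> k y)),
     mneg = (\<lambda>x. h (\<ominus>\<^bsub>M\<^esub> k x))\<rparr>)"

definition relabelling :: "('a multiring \<Rightarrow> 'a set \<Rightarrow> (('a \<Rightarrow> int) \<Rightarrow> int) \<Rightarrow> 'a) \<Rightarrow> bool" where
  "relabelling e \<longleftrightarrow> (\<forall>A T. p_multiring A T \<longrightarrow> inj_on (e A T) (carrier (Q A T)))"

lemma ex_relabelling: "\<exists>e :: 'a multiring \<Rightarrow> 'a set \<Rightarrow> (('a \<Rightarrow> int) \<Rightarrow> int) \<Rightarrow> 'a. relabelling e"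
proof
  show "relabelling (\<lambda>A T. inv_into (carrier A) (hat A T))"
    by (simp add: relabelling_def Q_def inj_on_inv_into)
qed

definition Q_copy_ob :: "('a multiring \<Rightarrow> 'a set \<Rightarrow> (('a \<Rightarrow> int) \<Rightarrow> int) \<Rightarrow> 'a)
    \<Rightarrow> 'a multiring \<times> 'a set \<Rightarrow> 'a multiring" where
  "Q_copy_ob e = (\<lambda>(A, T). copy (e A T) (Q A T))"

definition Q_copy_map :: "('a multiring \<Rightarrow> 'a set \<Rightarrow> (('a \<Rightarrow> int) \<Rightarrow> int) \<Rightarrow> 'a)
    \<Rightarrow> 'a multiring \<times> 'a set \<Rightarrow> 'a multiring \<times> 'a set \<Rightarrow> ('a \<Rightarrow> 'a) \<Rightarrow> ('a \<Rightarrow> 'a)" where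
  "Q_copy_map e = (\<lambda>(A, T) (B, P) f. \<lambda>x\<in>e A T ` carrier (Q A T).
     e B P (Q_map A T B P f (inv_into (carrier (Q A T)) (e A T) x)))"

end

theory Submission
  imports Defs
begin

text \<open>Everything rests on one existence result for signs, a Positivstellensatz
  (\<open>even_power_positivstellensatz\<close>): if every \<open>\<sigma>\<close> in \<open>sper_T A T\<close> vanishes at \<open>s\<close>, then \<open>T\<close>
  contains \<open>- s^(2n)\<close> for some \<open>n\<close>. As in real algebra it comes from Zorn's lemma: a preorder that
  is maximal among those containing \<open>T\<close> and avoiding all \<open>- s^(2n)\<close> is the nonnegativity cone of
  some \<open>\<sigma>\<close>.

  It is used as follows. Suppose that \<open>g\<close> and \<open>g'\<close> have the same image in \<open>Q A T\<close>. Then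
  \<open>g g'\<close> is positive wherever \<open>g\<close> is nonzero, and applying the Positivstellensatz to the preorder
  generated by \<open>T\<close> and \<open>- g g'\<close> yields an element \<open>G\<close> common to \<open>g^(2n+1) + \<Sigma> g T\<close> and
  \<open>g'^(2m+1) + \<Sigma> g' T\<close> (\<open>same_sign_common_multiple\<close>). This element has two uses.

  \<^item> In a real reduced multiring \<open>R\<close> with \<open>T = \<Sigma> R^2\<close> the identities \<open>g^3 = g\<close> and \<open>g + b^2 g = {g}\<close>
    collapse \<open>g^(2n+1) + \<Sigma> g T\<close> to \<open>{g}\<close>. Hence \<open>g = G = g'\<close>: signs separate the points of \<open>R\<close>
    (\<open>real_reduced_separated\<close>). This is why a morphism into \<open>R\<close> factors through \<open>Q A T\<close>.

  \<^item> In general, if \<open>g \<in> x + y\<close> then each \<open>G\<close> in \<open>g^(2n+1) + \<Sigma> g T\<close> lies in \<open>x' + y'\<close> for some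
    \<open>x'\<close>, \<open>y'\<close> with the signs of \<open>x\<close> and \<open>y\<close>: on expanding the power, every monomial has even
    degree in one of \<open>x\<close>, \<open>y\<close> and odd degree in the other. Therefore two sums with end results
    \<open>g\<close> and \<open>g'\<close> can be replaced by sums with the same end result \<open>G\<close>, to which associativity
    in \<open>A\<close> applies (\<open>add_assoc_mod_sign\<close>). This is associativity in \<open>Q A T\<close>; the other axioms of
    a real reduced multiring can be read off pointwise from signs.

  The remaining part is formal. The locale \<open>reduction\<close> describes a surjective morphism from \<open>A\<close>
  with the kernel and the induced sum of \<open>proj A T\<close>. It covers \<open>Q A T\<close> as well as its
  copies along injections, so that real reducedness, the universal property, functoriality and
  the adjunction need to be shown only once.\<close>

section \<open>Additive closures in a multiring\<close>

text \<open>Adding one generator at a time yields a set closed under addition, because the sum is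
  associative.\<close>

inductive_set addspan :: "'a multiring \<Rightarrow> 'a set \<Rightarrow> 'a set" for A X where
  zero: "\<zero>\<^bsub>A\<^esub> \<in> addspan A X"
| add: "\<lbrakk>x \<in> X; y \<in> addspan A X; z \<in> x \<oplus>\<^bsub>A\<^esub> y\<rbrakk> \<Longrightarrow> z \<in> addspan A X"

context multiring
begin

declare zero_closed [simp, intro] neg_closed [simp, intro]

lemma add_mem_closed [intro]: "\<lbrakk>x \<in> a \<oplus> b; a \<in> carrier A; b \<in> carrier A\<rbrakk> \<Longrightarrow> x \<in> carrier A"
  using add_closed by blast

lemma add_zero_eq [simp]: "a \<in> carrier A \<Longrightarrow> a \<oplus> \<zero> = {a}"
  using add_zero add_closed[of a \<zero>] by blast

lemma zero_add_eq [simp]: "a \<in> carrier A \<Longrightarrow> \<zero> \<oplus> a = {a}"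
  using add_comm[of \<zero> a] by simp

lemma zero_in_add_neg: "a \<in> carrier A \<Longrightarrow> \<zero> \<in> a \<oplus> \<ominus> a"
  using add_rev[of a a \<zero>] add_comm[of a "\<ominus> a"] by simp

lemma neg_unique: "\<lbrakk>\<zero> \<in> a \<oplus> b; a \<in> carrier A; b \<in> carrier A\<rbrakk> \<Longrightarrow> b = \<ominus> a"
  using add_rev[of \<zero> a b] add_zero[of b "\<ominus> a"] by blast

lemma neg_neg [simp]: "a \<in> carrier A \<Longrightarrow> \<ominus> (\<ominus> a) = a"
  by (rule neg_unique[symmetric]) (simp_all add: zero_in_add_neg add_comm[of "\<ominus> a" a])

lemma neg_zero [simp]: "\<ominus> \<zero> = \<zero>"
  by (rule neg_unique[symmetric]) simp_all

lemma zero_mult [simp]: "a \<in> carrier A \<Longrightarrow> \<zero> \<otimes> a = \<zero>"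
  using mult_zero[of a] by (simp add: m_comm)

lemma neg_mult_left: "\<lbrakk>a \<in> carrier A; b \<in> carrier A\<rbrakk> \<Longrightarrow> \<ominus> a \<otimes> b = \<ominus> (a \<otimes> b)"
  using distrib[of \<zero> a "\<ominus> a" b] zero_in_add_neg[of a] by (intro neg_unique) simp_all

lemma neg_mult_right: "\<lbrakk>a \<in> carrier A; b \<in> carrier A\<rbrakk> \<Longrightarrow> a \<otimes> \<ominus> b = \<ominus> (a \<otimes> b)"
  using neg_mult_left[of b a] by (simp add: m_comm)

lemma neg_add:
  assumes "c \<in> a \<oplus> b" "a \<in> carrier A" "b \<in> carrier A"
  shows "\<ominus> c \<in> \<ominus> a \<oplus> \<ominus> b"
proof -
  have "c \<in> carrier A" using assms by blast
  then show ?thesis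
    using distrib[of c a b "\<ominus> \<one>"] assms by (simp add: neg_mult_right)
qed

lemma add_solve_left:
  "\<lbrakk>a \<in> b \<oplus> c; b \<in> carrier A; c \<in> carrier A\<rbrakk> \<Longrightarrow> b \<in> a \<oplus> \<ominus> c"
  using add_rev[of a b c] by blast

lemma add_solve_right:
  "\<lbrakk>a \<in> b \<oplus> c; b \<in> carrier A; c \<in> carrier A\<rbrakk> \<Longrightarrow> c \<in> a \<oplus> \<ominus> b"
  using add_solve_left[of a c b] add_comm[of b c] by simp

lemma add_assoc_left:
  assumes "h \<in> b \<oplus> c" "x \<in> a \<oplus> h" "a \<in> carrier A" "b \<in> carrier A" "c \<in> carrier A"
  obtains g where "g \<in> a \<oplus> b" "x \<in> g \<oplus> c"
proof -
  have h: "h \<in> carrier A" using assms by blast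
  have "h \<in> c \<oplus> b" "x \<in> h \<oplus> a" using assms h add_comm[of b c] add_comm[of a h] by auto
  then obtain g where "g \<in> b \<oplus> a" "x \<in> c \<oplus> g" using assms add_assoc[of c b a h x] by blast
  moreover have "g \<in> carrier A" using \<open>g \<in> b \<oplus> a\<close> assms by blast
  ultimately show thesis using that add_comm[of b a] add_comm[of c g] assms by simp
qed

lemma add_assoc_right:
  assumes "g \<in> a \<oplus> b" "x \<in> g \<oplus> c" "a \<in> carrier A" "b \<in> carrier A" "c \<in> carrier A"
  obtains h where "h \<in> b \<oplus> c" "x \<in> a \<oplus> h"
  using add_assoc[of a b c g x] assms by blast

text \<open>The only form of associativity and commutativity that is needed for sums of four elements:
  set-valued sums cannot be regrouped by rewriting.\<close>

lemma add_interchange: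
  assumes "x \<in> g \<oplus> h" "g \<in> a \<oplus> b" "h \<in> c \<oplus> d"
    and [simp]: "a \<in> carrier A" "b \<in> carrier A" "c \<in> carrier A" "d \<in> carrier A"
  obtains p q where "p \<in> a \<oplus> c" "q \<in> b \<oplus> d" "x \<in> p \<oplus> q"
proof -
  have [simp]: "g \<in> carrier A" "h \<in> carrier A" using assms by blast+
  obtain k where k: "k \<in> b \<oplus> h" "x \<in> a \<oplus> k"
    using assms by (elim add_assoc_right[of g a b x h]) auto
  obtain l where l: "l \<in> b \<oplus> c" "k \<in> l \<oplus> d"
    using assms k by (elim add_assoc_left[of h c d k b]) auto
  have [simp]: "l \<in> carrier A" "k \<in> carrier A" using k l by auto
  have "l \<in> c \<oplus> b" using l add_comm[of b c] by simp
  then obtain q where q: "q \<in> b \<oplus> d" "k \<in> c \<oplus> q"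
    using l by (elim add_assoc_right[of l c b k d]) auto
  then obtain p where "p \<in> a \<oplus> c" "x \<in> p \<oplus> q"
    using k by (elim add_assoc_left[of k c q x a]) auto
  with q show thesis using that by blast
qed

lemma pow_two: "x \<in> carrier A \<Longrightarrow> x [^] (2::nat) = x \<otimes> x"
  by (simp add: numeral_2_eq_2)

lemma preorder_of_iff:
  "preorder_of A T \<longleftrightarrow> T \<subseteq> carrier A \<and> (\<forall>x\<in>carrier A. x \<otimes> x \<in> T) \<and>
     (\<forall>x\<in>T. \<forall>y\<in>T. x \<otimes> y \<in> T) \<and> (\<forall>x\<in>T. \<forall>y\<in>T. x \<oplus> y \<subseteq> T)"
proof -
  have "squares A \<subseteq> T \<longleftrightarrow> (\<forall>x\<in>carrier A. x \<otimes> x \<in> T)"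
    unfolding squares_def using pow_two by fastforce
  moreover have "set_prod A T T \<subseteq> T \<longleftrightarrow> (\<forall>x\<in>T. \<forall>y\<in>T. x \<otimes> y \<in> T)"
    unfolding set_prod_def by blast
  moreover have "set_sum A T T \<subseteq> T \<longleftrightarrow> (\<forall>x\<in>T. \<forall>y\<in>T. x \<oplus> y \<subseteq> T)"
    unfolding set_sum_def by blast
  ultimately show ?thesis unfolding preorder_of_def by simp
qed

lemma addspan_closed: "X \<subseteq> carrier A \<Longrightarrow> addspan A X \<subseteq> carrier A"
proof
  show "x \<in> carrier A" if "x \<in> addspan A X" "X \<subseteq> carrier A" for x
    using that by (induction rule: addspan.induct) auto
qed

lemma addspan_superset: "X \<subseteq> carrier A \<Longrightarrow> X \<subseteq> addspan A X"
  using addspan.add[OF _ addspan.zero] by fastforce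

lemma addspan_add:
  assumes X: "X \<subseteq> carrier A" and "u \<in> addspan A X" "v \<in> addspan A X" "w \<in> u \<oplus> v"
  shows "w \<in> addspan A X"
  using assms(2-)
proof (induction arbitrary: w rule: addspan.induct)
  case zero
  then show ?case using addspan_closed[OF X] by auto
next
  case (add x y z)
  have "y \<in> carrier A" "v \<in> carrier A" "x \<in> carrier A"
    using add addspan_closed[OF X] X by auto
  then obtain h where "h \<in> y \<oplus> v" "w \<in> x \<oplus> h"
    using add by (elim add_assoc_right[of z x y w v]) auto
  then show ?case using add by (auto intro: addspan.add)
qed

lemma addspan_least:
  assumes "X \<subseteq> C" "\<zero> \<in> C" "\<And>x y. \<lbrakk>x \<in> C; y \<in> C\<rbrakk> \<Longrightarrow> x \<oplus> y \<subseteq> C"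
  shows "addspan A X \<subseteq> C"
proof
  show "x \<in> C" if "x \<in> addspan A X" for x
    using that by (induction rule: addspan.induct) (use assms in blast)+
qed

text \<open>Distributivity is only an inclusion, \<open>(x + y) d \<subseteq> x d + y d\<close>, but this is the direction in which
  a product with a sum lands in the sum of the products. In contrast, \<open>a T\<close> need not be closed
  under addition when \<open>T\<close> is; this is why additive closures of sets \<open>a T\<close> occur below.\<close>

lemma addspan_scale:
  assumes X: "X \<subseteq> carrier A" and d: "d \<in> carrier A" and Y: "\<And>x. x \<in> X \<Longrightarrow> x \<otimes> d \<in> addspan A Y"
    and YA: "Y \<subseteq> carrier A" and "u \<in> addspan A X"
  shows "u \<otimes> d \<in> addspan A Y"
  using assms(5)
proof (induction rule: addspan.induct)
  case zero
  then show ?case using d by (simp add: addspan.zero)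
next
  case (add x y z)
  have "x \<in> carrier A" "y \<in> carrier A" using add addspan_closed[OF X] X by auto
  then have "z \<otimes> d \<in> x \<otimes> d \<oplus> y \<otimes> d" using add d by (intro distrib) auto
  then show ?case using addspan_add[OF YA] Y add by blast
qed

lemma addspan_mult:
  assumes X: "X \<subseteq> carrier A" and Y: "Y \<subseteq> carrier A" and Z: "Z \<subseteq> carrier A"
    and XY: "\<And>x y. \<lbrakk>x \<in> X; y \<in> Y\<rbrakk> \<Longrightarrow> x \<otimes> y \<in> Z"
    and u: "u \<in> addspan A X" and v: "v \<in> addspan A Y"
  shows "u \<otimes> v \<in> addspan A Z"
proof (rule addspan_scale[OF X _ _ Z u])
  show vA: "v \<in> carrier A" using v addspan_closed[OF Y] by blast
  fix x assume x: "x \<in> X"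
  have "v \<otimes> x \<in> addspan A Z"
  proof (rule addspan_scale[OF Y _ _ Z v])
    show "x \<in> carrier A" using x X by blast
    show "y \<otimes> x \<in> addspan A Z" if "y \<in> Y" for y
      using XY[OF x that] addspan_superset[OF Z] m_comm that x X Y by (metis subsetD)
  qed
  then show "x \<otimes> v \<in> addspan A Z" using m_comm vA x X by (metis subsetD)
qed

lemma addspan_Un:
  assumes X: "X \<subseteq> carrier A" and Y: "Y \<subseteq> carrier A" and "w \<in> addspan A (X \<union> Y)"
  obtains u v where "u \<in> addspan A X" "v \<in> addspan A Y" "w \<in> u \<oplus> v"
proof -
  have "\<exists>u\<in>addspan A X. \<exists>v\<in>addspan A Y. w \<in> u \<oplus> v"
    using assms(3)
  proof (induction rule: addspan.induct)
    case zero
    show ?case by (intro bexI[of _ \<zero>]) (auto intro: addspan.zero)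
  next
    case (add x y z)
    then obtain u v where uv: "u \<in> addspan A X" "v \<in> addspan A Y" "y \<in> u \<oplus> v" by blast
    have [simp]: "u \<in> carrier A" "v \<in> carrier A" "x \<in> carrier A"
      using uv addspan_closed[OF X] addspan_closed[OF Y] add X Y by auto
    show ?case
    proof (cases "x \<in> X")
      case True
      obtain g where "g \<in> x \<oplus> u" "z \<in> g \<oplus> v"
        using add uv by (elim add_assoc_left[of y u v z x]) auto
      moreover have "g \<in> addspan A X" using addspan.add[OF True uv(1)] calculation by simp
      ultimately show ?thesis using uv(2) by blast
    next
      case False
      have "y \<in> v \<oplus> u" using uv add_comm[of u v] by simp
      then obtain g where g: "g \<in> x \<oplus> v" "z \<in> g \<oplus> u"
        using add uv by (elim add_assoc_left[of y v u z x]) auto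
      then have "g \<in> carrier A" by auto
      then have "g \<in> addspan A Y" "z \<in> u \<oplus> g"
        using g False add.hyps(1) uv(2) addspan.add[of x Y v A g] add_comm[of u g] by auto
      then show ?thesis using uv(1) by blast
    qed
  qed
  then show thesis using that by blast
qed

lemma preorder_addspan:
  assumes X: "X \<subseteq> carrier A" and "\<And>x. x \<in> carrier A \<Longrightarrow> x \<otimes> x \<in> X"
    and "\<And>x y. \<lbrakk>x \<in> X; y \<in> X\<rbrakk> \<Longrightarrow> x \<otimes> y \<in> X"
  shows "preorder_of A (addspan A X)"
  unfolding preorder_of_iff
proof (intro conjI ballI subsetI)
  show "x \<in> carrier A" if "x \<in> addspan A X" for x
    using that addspan_closed[OF X] by blast
  show "x \<otimes> x \<in> addspan A X" if "x \<in> carrier A" for x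
    using that assms(2) addspan_superset[OF X] by blast
  show "x \<otimes> y \<in> addspan A X" if "x \<in> addspan A X" "y \<in> addspan A X" for x y
    by (rule addspan_mult[OF X X X assms(3) that])
  show "z \<in> addspan A X" if "x \<in> addspan A X" "y \<in> addspan A X" "z \<in> x \<oplus> y" for x y z
    by (rule addspan_add[OF X that])
qed

text \<open>Since \<open>x + 0 = {x}\<close>, the sum of a one-element list needs no separate case.\<close>

lemma iter_sum_Cons:
  "\<lbrakk>x \<in> carrier A\<rbrakk> \<Longrightarrow> iter_sum A (x # xs) = set_sum A {x} (iter_sum A xs)"
  by (cases xs) (auto simp: set_sum_def)

lemma sum_squares_eq_addspan: "sum_squares A = addspan A (squares A)"
proof -
  have sq: "squares A \<subseteq> carrier A" "\<zero> \<in> squares A"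
    using nat_pow_closed by (auto simp: squares_def pow_two intro!: exI[of _ \<zero>])
  have "iter_sum A (map (\<lambda>x. x [^] (2::nat)) xs) \<subseteq> addspan A (squares A)"
    if "set xs \<subseteq> carrier A" for xs
    using that
  proof (induction xs)
    case Nil
    then show ?case by (auto intro: addspan.zero)
  next
    case (Cons x xs)
    then have "iter_sum A (map (\<lambda>x. x [^] (2::nat)) xs) \<subseteq> addspan A (squares A)" by simp
    moreover have "x [^] (2::nat) \<in> squares A" using Cons by (auto simp: squares_def)
    ultimately show ?case using Cons
      by (auto simp: iter_sum_Cons set_sum_def intro: addspan.add)
  qed
  moreover have "\<exists>xs. xs \<noteq> [] \<and> set xs \<subseteq> carrier A \<and> w \<in> iter_sum A (map (\<lambda>x. x [^] (2::nat)) xs)"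
    if "w \<in> addspan A (squares A)" for w
    using that
  proof (induction rule: addspan.induct)
    case zero
    show ?case by (intro exI[of _ "[\<zero>]"]) (simp add: pow_two)
  next
    case (add x y z)
    then obtain xs a where xs: "xs \<noteq> []" "set xs \<subseteq> carrier A" "y \<in> iter_sum A (map (\<lambda>x. x [^] (2::nat)) xs)"
      and a: "a \<in> carrier A" "x = a [^] (2::nat)" by (auto simp: squares_def)
    then show ?case using add
      by (intro exI[of _ "a # xs"]) (auto simp: iter_sum_Cons set_sum_def)
  qed
  ultimately show ?thesis
    unfolding sum_squares_def by (intro subset_antisym subsetI) (blast, simp)
qed

lemma preorder_sum_squares: "preorder_of A (sum_squares A)"
  unfolding sum_squares_eq_addspan
proof (rule preorder_addspan)
  show "squares A \<subseteq> carrier A" by (auto simp: squares_def)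
  show "x \<otimes> x \<in> squares A" if "x \<in> carrier A" for x
    unfolding squares_def using pow_two[OF that] that by (metis (mono_tags, lifting) mem_Collect_eq)
  show "x \<otimes> y \<in> squares A" if "x \<in> squares A" "y \<in> squares A" for x y
  proof -
    from that obtain a b where "a \<in> carrier A" "b \<in> carrier A" "x = a [^] (2::nat)" "y = b [^] (2::nat)"
      by (auto simp: squares_def)
    then show ?thesis
      unfolding squares_def by (auto simp: nat_pow_distrib intro!: exI[of _ "a \<otimes> b"])
  qed
qed

section \<open>A Positivstellensatz for preorders\<close>
lemma preorder_carrier: "\<lbrakk>preorder_of A T; x \<in> T\<rbrakk> \<Longrightarrow> x \<in> carrier A"
  and preorder_square: "\<lbrakk>preorder_of A T; x \<in> carrier A\<rbrakk> \<Longrightarrow> x \<otimes> x \<in> T"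
  and preorder_mult: "\<lbrakk>preorder_of A T; x \<in> T; y \<in> T\<rbrakk> \<Longrightarrow> x \<otimes> y \<in> T"
  and preorder_add: "\<lbrakk>preorder_of A T; x \<in> T; y \<in> T; z \<in> x \<oplus> y\<rbrakk> \<Longrightarrow> z \<in> T"
  unfolding preorder_of_iff by blast+

lemma preorder_zero: "preorder_of A T \<Longrightarrow> \<zero> \<in> T"
  using preorder_square[of T \<zero>] by simp

lemma preorder_one: "preorder_of A T \<Longrightarrow> \<one> \<in> T"
  using preorder_square[of T \<one>] by simp

lemma preorder_even_power:
  "\<lbrakk>preorder_of A T; s \<in> carrier A\<rbrakk> \<Longrightarrow> (s \<otimes> s) [^] (n::nat) \<in> T"
  by (induction n) (auto simp: preorder_one preorder_square preorder_mult)

lemma addspan_preorder: "preorder_of A T \<Longrightarrow> addspan A T \<subseteq> T"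
  by (rule addspan_least) (use preorder_add preorder_zero in blast)+

lemma mult_add_add:
  assumes "x \<in> a \<oplus> b" "y \<in> c \<oplus> d"
    and [simp]: "a \<in> carrier A" "b \<in> carrier A" "c \<in> carrier A" "d \<in> carrier A"
  obtains g h where "g \<in> a \<otimes> c \<oplus> a \<otimes> d" "h \<in> b \<otimes> c \<oplus> b \<otimes> d" "x \<otimes> y \<in> g \<oplus> h"
proof
  have [simp]: "x \<in> carrier A" "y \<in> carrier A" using assms by auto
  show "x \<otimes> y \<in> a \<otimes> y \<oplus> b \<otimes> y" using assms by (intro distrib) auto
  have "y \<otimes> a \<in> c \<otimes> a \<oplus> d \<otimes> a" "y \<otimes> b \<in> c \<otimes> b \<oplus> d \<otimes> b"
    using assms by (auto intro!: distrib)
  then show "a \<otimes> y \<in> a \<otimes> c \<oplus> a \<otimes> d" "b \<otimes> y \<in> b \<otimes> c \<oplus> b \<otimes> d"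
    using m_comm[of a] m_comm[of b] by simp_all
qed

lemma scaled_closed: "\<lbrakk>preorder_of A T; a \<in> carrier A\<rbrakk> \<Longrightarrow> (\<otimes>) a ` T \<subseteq> carrier A"
  using preorder_carrier by auto

text \<open>The generating set \<open>T \<union> a T\<close> is closed under products because \<open>a\<^sup>2 \<in> T\<close>, and hence so is its
  additive closure.\<close>

lemma preorder_adjoin:
  assumes T: "preorder_of A T" and a: "a \<in> carrier A"
  shows "preorder_of A (addspan A (T \<union> (\<otimes>) a ` T))"
proof (rule preorder_addspan)
  note [simp] = preorder_carrier[OF T]
  show "T \<union> (\<otimes>) a ` T \<subseteq> carrier A" using a by auto
  show "x \<otimes> x \<in> T \<union> (\<otimes>) a ` T" if "x \<in> carrier A" for x
    using preorder_square[OF T that] by blast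
  fix x y assume x: "x \<in> T \<union> (\<otimes>) a ` T" and y: "y \<in> T \<union> (\<otimes>) a ` T"
  show "x \<otimes> y \<in> T \<union> (\<otimes>) a ` T"
  proof (cases "x \<in> T"; cases "y \<in> T")
    assume "x \<in> T" "y \<in> T"
    then show ?thesis using preorder_mult[OF T] by blast
  next
    assume "x \<in> T" "y \<notin> T"
    then obtain t where t: "t \<in> T" "y = a \<otimes> t" using y by blast
    then have "x \<otimes> y = a \<otimes> (x \<otimes> t)" using a \<open>x \<in> T\<close> by (simp add: m_lcomm)
    then show ?thesis using preorder_mult[OF T] t \<open>x \<in> T\<close> by blast
  next
    assume "x \<notin> T" "y \<in> T"
    then obtain t where t: "t \<in> T" "x = a \<otimes> t" using x by blast
    then have "x \<otimes> y = a \<otimes> (t \<otimes> y)" using a \<open>y \<in> T\<close> by (simp add: m_assoc)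
    then show ?thesis using preorder_mult[OF T] t \<open>y \<in> T\<close> by blast
  next
    assume "x \<notin> T" "y \<notin> T"
    then obtain t u where t: "t \<in> T" "x = a \<otimes> t" "u \<in> T" "y = a \<otimes> u" using x y by blast
    then have "x \<otimes> y = (a \<otimes> a) \<otimes> (t \<otimes> u)" using a by (simp add: m_ac)
    then show ?thesis using preorder_mult[OF T] preorder_square[OF T a] t by auto
  qed
qed

text \<open>A membership \<open>- e \<in> T[c]\<close> is put in the form of an element of \<open>e + T\<close> that is the negative of a sum
  of \<open>c\<close>-multiples; two such elements can be multiplied with each other.\<close>

lemma neg_mem_adjoin:
  assumes T: "preorder_of A T" and c: "c \<in> carrier A" and e: "e \<in> carrier A"
    and "\<ominus> e \<in> addspan A (T \<union> (\<otimes>) c ` T)"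
  obtains p u where "p \<in> T" "u \<in> addspan A ((\<otimes>) c ` T)" "\<ominus> u \<in> e \<oplus> p"
proof -
  have sub: "T \<subseteq> carrier A" "(\<otimes>) c ` T \<subseteq> carrier A"
    using preorder_carrier[OF T] scaled_closed[OF T c] by auto
  obtain p u where pu: "p \<in> addspan A T" "u \<in> addspan A ((\<otimes>) c ` T)" "\<ominus> e \<in> p \<oplus> u"
    using addspan_Un[OF sub assms(4)] .
  have p: "p \<in> T" using pu(1) addspan_preorder[OF T] by blast
  have [simp]: "p \<in> carrier A" "u \<in> carrier A"
    using p pu(2) preorder_carrier[OF T] addspan_closed[OF sub(2)] by auto
  have "e \<in> \<ominus> p \<oplus> \<ominus> u" using neg_add[OF pu(3)] e by simp
  then have "\<ominus> u \<in> e \<oplus> \<ominus> (\<ominus> p)" by (rule add_solve_right) auto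
  then show thesis using that p pu(2) by simp
qed

text \<open>If neither \<open>a\<close> nor \<open>b\<close> is in \<open>P\<close>, then by maximality adjoining either of them captures some
  \<open>- s^(2n)\<close>, so some element of \<open>s^(2n) + P\<close> is minus a sum of multiples of \<open>a\<close>, and likewise for
  \<open>b\<close>. In the product of the two the signs cancel: it lies in \<open>s^(2(n+m)) + P\<close> and is a sum of
  \<open>P\<close>-multiples of \<open>a b\<close>, hence in \<open>- P\<close>. This forces \<open>- s^(2(n+m))\<close> into \<open>P\<close>.

  The single hypothesis \<open>- a b \<in> P\<close> serves two purposes. For \<open>b = - a\<close> it is \<open>a\<^sup>2 \<in> P\<close>, and the
  conclusion is that \<open>P\<close> is total; for \<open>a b\<close> in \<open>P \<inter> - P\<close>, used with all choices of signs for \<open>a\<close>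
  and \<open>b\<close>, it says that \<open>P \<inter> - P\<close> is prime.\<close>

lemma maximal_preorder_neg_mult:
  assumes P: "preorder_of A P" and s: "s \<in> carrier A"
    and avoid: "\<And>n::nat. \<ominus> ((s \<otimes> s) [^] n) \<notin> P"
    and max: "\<And>P'. \<lbrakk>preorder_of A P'; P \<subseteq> P'; \<And>n::nat. \<ominus> ((s \<otimes> s) [^] n) \<notin> P'\<rbrakk> \<Longrightarrow> P' \<subseteq> P"
    and a: "a \<in> carrier A" and b: "b \<in> carrier A" and ab: "\<ominus> (a \<otimes> b) \<in> P"
  shows "a \<in> P \<or> b \<in> P"
proof (rule ccontr)
  assume not: "\<not> (a \<in> P \<or> b \<in> P)"
  note PA [simp] = preorder_carrier[OF P]
  have [simp]: "s \<otimes> s \<in> carrier A" using s by simp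
  \<comment> \<open>Maximality: adjoining \<open>c\<close> to \<open>P\<close> captures some \<open>- s^(2n)\<close>.\<close>
  have *: "\<exists>(n::nat) p u. p \<in> P \<and> u \<in> addspan A ((\<otimes>) c ` P) \<and> \<ominus> u \<in> (s \<otimes> s) [^] n \<oplus> p"
    if c: "c \<in> carrier A" "c \<notin> P" for c
  proof -
    let ?P' = "addspan A (P \<union> (\<otimes>) c ` P)"
    have sub: "P \<union> (\<otimes>) c ` P \<subseteq> ?P'"
      using scaled_closed[OF P c(1)] PA by (intro addspan_superset) auto
    have "c = c \<otimes> \<one>" using c by simp
    then have "c \<in> ?P'" using sub preorder_one[OF P] by blast
    then obtain n :: nat where "\<ominus> ((s \<otimes> s) [^] n) \<in> ?P'"
      using max[of ?P'] preorder_adjoin[OF P c(1)] sub c(2) by blast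
    then show ?thesis using neg_mem_adjoin[OF P c(1)] by (metis nat_pow_closed \<open>s \<otimes> s \<in> carrier A\<close>)
  qed
  obtain n :: nat and p u where u: "p \<in> P" "u \<in> addspan A ((\<otimes>) a ` P)" "\<ominus> u \<in> (s \<otimes> s) [^] n \<oplus> p"
    using *[of a] a not by blast
  obtain m :: nat and q v where v: "q \<in> P" "v \<in> addspan A ((\<otimes>) b ` P)" "\<ominus> v \<in> (s \<otimes> s) [^] m \<oplus> q"
    using *[of b] b not by blast
  have uA [simp]: "u \<in> carrier A" and vA [simp]: "v \<in> carrier A"
    using u v addspan_closed[OF scaled_closed[OF P]] a b by blast+
  have uv: "\<ominus> u \<otimes> \<ominus> v = u \<otimes> v" by (simp add: neg_mult_left neg_mult_right)
  obtain g h where g: "g \<in> (s \<otimes> s) [^] n \<otimes> (s \<otimes> s) [^] m \<oplus> (s \<otimes> s) [^] n \<otimes> q"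
    and h: "h \<in> p \<otimes> (s \<otimes> s) [^] m \<oplus> p \<otimes> q" and gh: "u \<otimes> v \<in> g \<oplus> h"
    by (rule mult_add_add[OF u(3) v(3), unfolded uv]) (use u v in auto)
  have h': "h \<in> P"
    by (rule preorder_add[OF P _ _ h]) (use u v preorder_mult[OF P] preorder_even_power[OF P s] in auto)
  obtain r where r: "r \<in> (s \<otimes> s) [^] n \<otimes> q \<oplus> h" "u \<otimes> v \<in> (s \<otimes> s) [^] n \<otimes> (s \<otimes> s) [^] m \<oplus> r"
    by (rule add_assoc_right[OF g gh]) (use v h' in auto)
  have rP: "r \<in> P"
    by (rule preorder_add[OF P _ _ r(1)]) (use v h' preorder_mult[OF P] preorder_even_power[OF P s] in auto)
  let ?e = "(s \<otimes> s) [^] (n + m)"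
  have "u \<otimes> v \<in> ?e \<oplus> r" using r(2) by (simp add: nat_pow_mult)
  then have "?e \<in> u \<otimes> v \<oplus> \<ominus> r" by (rule add_solve_left) (use rP in auto)
  then have e: "\<ominus> ?e \<in> \<ominus> (u \<otimes> v) \<oplus> r" using neg_add[of ?e "u \<otimes> v" "\<ominus> r"] rP by simp
  \<comment> \<open>On the other hand, \<open>u v\<close> is a sum of elements of \<open>a b P\<close>, which is contained in \<open>- P\<close>.\<close>
  have "u \<otimes> v \<in> addspan A ((\<otimes>) (a \<otimes> b) ` P)"
  proof (rule addspan_mult[OF scaled_closed[OF P a] scaled_closed[OF P b] scaled_closed[OF P] _ u(2) v(2)])
    show "a \<otimes> b \<in> carrier A" using a b by simp
    fix x y assume "x \<in> (\<otimes>) a ` P" "y \<in> (\<otimes>) b ` P"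
    then obtain t t' where t: "t \<in> P" "t' \<in> P" "x = a \<otimes> t" "y = b \<otimes> t'" by blast
    then have "x \<otimes> y = (a \<otimes> b) \<otimes> (t \<otimes> t')" using a b by (simp add: m_ac)
    then show "x \<otimes> y \<in> (\<otimes>) (a \<otimes> b) ` P" using t preorder_mult[OF P] by blast
  qed
  then have "(u \<otimes> v) \<otimes> \<ominus> \<one> \<in> addspan A P"
  proof (rule addspan_scale[rotated -1])
    show "(\<otimes>) (a \<otimes> b) ` P \<subseteq> carrier A" using scaled_closed[OF P] a b by simp
    show "P \<subseteq> carrier A" using PA by blast
    then have PP: "P \<subseteq> addspan A P" by (rule addspan_superset)
    fix x assume "x \<in> (\<otimes>) (a \<otimes> b) ` P"
    then obtain t where t: "t \<in> P" "x = (a \<otimes> b) \<otimes> t" by blast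
    then have "x \<otimes> \<ominus> \<one> = \<ominus> (a \<otimes> b) \<otimes> t" using a b by (simp add: neg_mult_left neg_mult_right)
    then show "x \<otimes> \<ominus> \<one> \<in> addspan A P" using PP t preorder_mult[OF P ab] by auto
  qed auto
  then have "\<ominus> (u \<otimes> v) \<in> P" using addspan_preorder[OF P] by (auto simp: neg_mult_right)
  then have "\<ominus> ?e \<in> P" using preorder_add[OF P _ rP e] by blast
  then show False using avoid by blast
qed

lemma multi_hom_threeI:
  assumes "\<sigma> \<in> carrier A \<rightarrow>\<^sub>E {- 1, 0, 1}"
    and "\<And>a b c. \<lbrakk>c \<in> a \<oplus> b; a \<in> carrier A; b \<in> carrier A\<rbrakk> \<Longrightarrow> \<sigma> c \<in> \<sigma> a \<oplus>\<^bsub>three\<^esub> \<sigma> b"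
    and "\<And>a b. \<lbrakk>a \<in> carrier A; b \<in> carrier A\<rbrakk> \<Longrightarrow> \<sigma> (a \<otimes> b) = \<sigma> a * \<sigma> b"
    and "\<And>a. a \<in> carrier A \<Longrightarrow> \<sigma> (\<ominus> a) = - \<sigma> a" and "\<sigma> \<zero> = 0" "\<sigma> \<one> = 1"
  shows "\<sigma> \<in> multi_hom A three"
  using assms by (simp add: multi_hom_def three_def)

text \<open>A total preorder with prime support is the nonnegativity cone of its sign function. For a sum
  \<open>c \<in> a + b\<close> the possible signs are excluded one by one by solving for one of the three elements
  and using that \<open>P\<close> and \<open>- P\<close> are closed under addition.\<close>

lemma sign_in_sper_T:
  assumes P: "preorder_of A P" and total: "\<And>a. a \<in> carrier A \<Longrightarrow> a \<in> P \<or> \<ominus> a \<in> P"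
    and prime: "\<And>a b. \<lbrakk>a \<in> carrier A; b \<in> carrier A; a \<otimes> b \<in> P; \<ominus> (a \<otimes> b) \<in> P\<rbrakk>
      \<Longrightarrow> (a \<in> P \<and> \<ominus> a \<in> P) \<or> (b \<in> P \<and> \<ominus> b \<in> P)"
    and proper: "\<ominus> \<one> \<notin> P"
  shows "(\<lambda>a\<in>carrier A. if a \<in> P then if \<ominus> a \<in> P then 0 else 1 else - 1) \<in> sper_T A P"
    (is "?\<sigma> \<in> _")
proof -
  have add: "?\<sigma> c \<in> ?\<sigma> a \<oplus>\<^bsub>three\<^esub> ?\<sigma> b"
    if c: "c \<in> a \<oplus> b" and [simp]: "a \<in> carrier A" "b \<in> carrier A" for a b c
  proof -
    have [simp]: "c \<in> carrier A" using that by auto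
    have n: "\<ominus> c \<in> \<ominus> a \<oplus> \<ominus> b" using neg_add[OF c] by simp
    have 1: "a \<in> P \<Longrightarrow> b \<in> P \<Longrightarrow> c \<in> P" using preorder_add[OF P _ _ c] .
    have 2: "\<ominus> a \<in> P \<Longrightarrow> \<ominus> b \<in> P \<Longrightarrow> \<ominus> c \<in> P" using preorder_add[OF P _ _ n] .
    have 3: "c \<in> P \<Longrightarrow> \<ominus> b \<in> P \<Longrightarrow> a \<in> P" using preorder_add[OF P _ _ add_solve_left[OF c]] by simp
    have 4: "\<ominus> c \<in> P \<Longrightarrow> b \<in> P \<Longrightarrow> \<ominus> a \<in> P" using preorder_add[OF P _ _ add_solve_left[OF n]] by simp
    have 5: "c \<in> P \<Longrightarrow> \<ominus> a \<in> P \<Longrightarrow> b \<in> P" using preorder_add[OF P _ _ add_solve_right[OF c]] by simp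
    have 6: "\<ominus> c \<in> P \<Longrightarrow> a \<in> P \<Longrightarrow> \<ominus> b \<in> P" using preorder_add[OF P _ _ add_solve_right[OF n]] by simp
    show ?thesis using 1 2 3 4 5 6 total[of a] total[of b] total[of c] by (auto simp: three_def)
  qed
  have mult: "?\<sigma> (a \<otimes> b) = ?\<sigma> a * ?\<sigma> b"
    if [simp]: "a \<in> carrier A" "b \<in> carrier A" for a b
  proof -
    have 1: "a \<in> P \<Longrightarrow> b \<in> P \<Longrightarrow> a \<otimes> b \<in> P" using preorder_mult[OF P] .
    have 2: "\<ominus> a \<in> P \<Longrightarrow> b \<in> P \<Longrightarrow> \<ominus> (a \<otimes> b) \<in> P"
      using preorder_mult[OF P, of "\<ominus> a" b] by (simp add: neg_mult_left)
    have 3: "a \<in> P \<Longrightarrow> \<ominus> b \<in> P \<Longrightarrow> \<ominus> (a \<otimes> b) \<in> P"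
      using preorder_mult[OF P, of a "\<ominus> b"] by (simp add: neg_mult_right)
    have 4: "\<ominus> a \<in> P \<Longrightarrow> \<ominus> b \<in> P \<Longrightarrow> a \<otimes> b \<in> P"
      using preorder_mult[OF P, of "\<ominus> a" "\<ominus> b"] by (simp add: neg_mult_right neg_mult_left)
    show ?thesis using 1 2 3 4 prime[of a b] total[of a] total[of b] by auto
  qed
  have neg: "?\<sigma> (\<ominus> a) = - ?\<sigma> a" if "a \<in> carrier A" for a
    using total[OF that] that by auto
  have "?\<sigma> \<zero> = 0" "?\<sigma> \<one> = 1" using preorder_zero[OF P] preorder_one[OF P] proper by auto
  moreover have "?\<sigma> \<in> carrier A \<rightarrow>\<^sub>E {- 1, 0, 1}" by auto
  moreover have "?\<sigma> ` P \<subseteq> {0, 1}" using preorder_carrier[OF P] by auto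
  moreover note add mult neg
  ultimately show ?thesis
    unfolding sper_T_def sper_def by (intro CollectI conjI multi_hom_threeI)
qed

text \<open>For \<open>s = 1\<close> this is the existence of a point of \<open>sper_T A T\<close> for every proper preorder \<open>T\<close>. The
  general case amounts to inverting \<open>s\<close>: if \<open>s\<close> had sign zero at the point given by the maximal
  preorder \<open>P\<close>, then \<open>- s\<^sup>2 \<in> P\<close>.\<close>

lemma even_power_positivstellensatz:
  assumes T: "preorder_of A T" and s: "s \<in> carrier A" and vanish: "\<And>\<sigma>. \<sigma> \<in> sper_T A T \<Longrightarrow> \<sigma> s = 0"
  obtains n :: nat where "\<ominus> ((s \<otimes> s) [^] n) \<in> T"
proof (rule ccontr)
  assume "\<not> thesis"
  then have avoid: "\<ominus> ((s \<otimes> s) [^] n) \<notin> T" for n :: nat using that by blast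
  let ?F = "{P. preorder_of A P \<and> T \<subseteq> P \<and> (\<forall>n::nat. \<ominus> ((s \<otimes> s) [^] n) \<notin> P)}"
  have "\<exists>P\<in>?F. \<forall>Q\<in>?F. P \<subseteq> Q \<longrightarrow> Q = P"
  proof (rule subset_Zorn_nonempty)
    show "?F \<noteq> {}" using T avoid by blast
    fix \<C> assume \<C>: "\<C> \<noteq> {}" "subset.chain ?F \<C>"
    then have pre: "preorder_of A P" "T \<subseteq> P" "\<And>n::nat. \<ominus> ((s \<otimes> s) [^] n) \<notin> P" if "P \<in> \<C>" for P
      using that by (auto simp: subset.chain_def)
    have joint: "\<exists>P\<in>\<C>. x \<in> P \<and> y \<in> P" if xy: "x \<in> \<Union>\<C>" "y \<in> \<Union>\<C>" for x y
    proof -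
      obtain X Y where "X \<in> \<C>" "Y \<in> \<C>" "x \<in> X" "y \<in> Y" using xy by blast
      moreover have "X \<subseteq> Y \<or> Y \<subseteq> X" using calculation \<C>(2) unfolding subset_chain_def by blast
      ultimately show ?thesis by blast
    qed
    have "preorder_of A (\<Union>\<C>)"
      unfolding preorder_of_iff
    proof (intro conjI ballI subsetI)
      show "x \<in> carrier A" if "x \<in> \<Union>\<C>" for x using that pre preorder_carrier by blast
      show "x \<otimes> x \<in> \<Union>\<C>" if "x \<in> carrier A" for x
        using that \<C>(1) pre(1) preorder_square by blast
      fix x y assume xy: "x \<in> \<Union>\<C>" "y \<in> \<Union>\<C>"
      then obtain P where P: "P \<in> \<C>" "x \<in> P" "y \<in> P" using joint by blast
      show "x \<otimes> y \<in> \<Union>\<C>" using P pre(1) preorder_mult by blast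
      show "z \<in> \<Union>\<C>" if "z \<in> x \<oplus> y" for z using that P pre(1) preorder_add by blast
    qed
    moreover have "T \<subseteq> \<Union>\<C>" using \<C>(1) pre(2) by blast
    ultimately show "\<Union>\<C> \<in> ?F" using pre(3) by blast
  qed
  then obtain P where PF: "P \<in> ?F" and maxF: "\<forall>Q\<in>?F. P \<subseteq> Q \<longrightarrow> Q = P" by (rule bexE)
  then have P: "preorder_of A P" "T \<subseteq> P" and avoidP: "\<And>n::nat. \<ominus> ((s \<otimes> s) [^] n) \<notin> P"
    by auto
  have max: "Q \<subseteq> P" if "preorder_of A Q" "P \<subseteq> Q" "\<And>n::nat. \<ominus> ((s \<otimes> s) [^] n) \<notin> Q" for Q
  proof -
    have "Q \<in> ?F" using that P(2) by blast
    then show ?thesis using maxF that(2) by simp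
  qed
  have split: "a \<in> P \<or> b \<in> P" if "a \<in> carrier A" "b \<in> carrier A" "\<ominus> (a \<otimes> b) \<in> P" for a b
    by (rule maximal_preorder_neg_mult[OF P(1) s avoidP max that])
  have total: "a \<in> P \<or> \<ominus> a \<in> P" if a: "a \<in> carrier A" for a
    using split[of a "\<ominus> a"] preorder_square[OF P(1) a] a by (simp add: neg_mult_right)
  have prime: "(a \<in> P \<and> \<ominus> a \<in> P) \<or> (b \<in> P \<and> \<ominus> b \<in> P)"
    if "a \<in> carrier A" "b \<in> carrier A" "a \<otimes> b \<in> P" "\<ominus> (a \<otimes> b) \<in> P" for a b
    using split[of a b] split[of "\<ominus> a" b] split[of a "\<ominus> b"] split[of "\<ominus> a" "\<ominus> b"] that
    by (auto simp: neg_mult_left neg_mult_right)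
  have proper: "\<ominus> \<one> \<notin> P" using avoidP[of 0] by simp
  let ?\<sigma> = "\<lambda>a\<in>carrier A. if a \<in> P then if \<ominus> a \<in> P then 0 else 1 else - (1::int)"
  have "?\<sigma> \<in> sper_T A P" by (rule sign_in_sper_T[OF P(1) total prime proper])
  then have "?\<sigma> \<in> sper_T A T" using P(2) unfolding sper_T_def by blast
  then have "?\<sigma> s = 0" by (rule vanish)
  then have "\<ominus> s \<in> P" "s \<in> P" using s by (auto split: if_splits)
  then have "\<ominus> ((s \<otimes> s) [^] (1::nat)) \<in> P"
    using preorder_mult[OF P(1), of "\<ominus> s" s] s by (simp add: neg_mult_left)
  then show False using avoidP by blast
qed

end

section \<open>Elements with equal signs\<close>

lemma three_add_eq:
  "x \<oplus>\<^bsub>three\<^esub> y = (if x = 0 then {y} else if y = 0 then {x} else if x = y then {x} else {-1, 0, 1})"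
  by (simp add: three_def)

text \<open>Adding such an element to a member of the sign class of \<open>x\<close> does not lead out of
  that class.\<close>

definition sign_cone :: "'a multiring \<Rightarrow> 'a set \<Rightarrow> 'a \<Rightarrow> 'a set" where
  "sign_cone A T x = {v \<in> carrier A. \<forall>\<sigma>\<in>sper_T A T. \<sigma> v = 0 \<or> \<sigma> v = \<sigma> x}"

definition sign_class :: "'a multiring \<Rightarrow> 'a set \<Rightarrow> 'a \<Rightarrow> 'a set" where
  "sign_class A T x = {v \<in> carrier A. \<forall>\<sigma>\<in>sper_T A T. \<sigma> v = \<sigma> x}"

lemma hat_eq_iff: "hat A T a = hat A T b \<longleftrightarrow> (\<forall>\<sigma>\<in>sper_T A T. \<sigma> a = \<sigma> b)"
  by (auto simp: hat_def restrict_def fun_eq_iff)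

context multiring
begin

context
  fixes T \<sigma>
  assumes \<sigma>: "\<sigma> \<in> sper_T A T"
begin

lemma sper_T_value: "a \<in> carrier A \<Longrightarrow> \<sigma> a \<in> {-1, 0, 1}"
  and sper_T_mult: "\<lbrakk>a \<in> carrier A; b \<in> carrier A\<rbrakk> \<Longrightarrow> \<sigma> (a \<otimes> b) = \<sigma> a * \<sigma> b"
  and sper_T_neg: "a \<in> carrier A \<Longrightarrow> \<sigma> (\<ominus> a) = - \<sigma> a"
  and sper_T_zero: "\<sigma> \<zero> = 0"
  and sper_T_one: "\<sigma> \<one> = 1"
  and sper_T_nonneg: "a \<in> T \<Longrightarrow> \<sigma> a = 0 \<or> \<sigma> a = 1"
  using \<sigma> by (auto simp: sper_T_def sper_def multi_hom_def three_def)

lemma sper_T_add: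
  "\<lbrakk>c \<in> a \<oplus> b; a \<in> carrier A; b \<in> carrier A\<rbrakk> \<Longrightarrow> \<sigma> c \<in> \<sigma> a \<oplus>\<^bsub>three\<^esub> \<sigma> b"
proof -
  assume "c \<in> a \<oplus> b" "a \<in> carrier A" "b \<in> carrier A"
  moreover have "c \<in> carrier A" using calculation by blast
  ultimately show ?thesis using \<sigma> by (simp add: sper_T_def sper_def multi_hom_def)
qed

end

text \<open>At a sign that is nonnegative on \<open>T\<close> and on \<open>- g g'\<close>, the value of \<open>g g' = g\<^sup>2\<close> is zero. Hence
  \<open>- g^(2n)\<close> is in \<open>T[- g g']\<close>, which says that \<open>g^(2n) + T\<close> meets the sums of elements of
  \<open>g g' T\<close>. Multiplication by \<open>g\<close> turns the latter into sums of elements of \<open>g' (g\<^sup>2 T) \<subseteq> g' T\<close>.\<close>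

lemma same_sign_half_multiple:
  assumes T: "preorder_of A T" and g: "g \<in> carrier A" and g': "g' \<in> carrier A"
    and eq: "hat A T g = hat A T g'"
  obtains n :: nat and t H where
    "t \<in> T" "H \<in> (g \<otimes> g) [^] n \<otimes> g \<oplus> g \<otimes> t" "H \<in> addspan A ((\<otimes>) g' ` T)"
proof -
  let ?c = "\<ominus> (g \<otimes> g')"
  let ?T' = "addspan A (T \<union> (\<otimes>) ?c ` T)"
  have c: "?c \<in> carrier A" using g g' by simp
  have "T \<union> (\<otimes>) ?c ` T \<subseteq> ?T'"
    using scaled_closed[OF T c] preorder_carrier[OF T] by (intro addspan_superset) auto
  moreover have "?c = ?c \<otimes> \<one>" using c by simp
  ultimately have sub: "T \<subseteq> ?T'" "?c \<in> ?T'" using preorder_one[OF T] by blast+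
  have "\<sigma> g = 0" if \<sigma>: "\<sigma> \<in> sper_T A ?T'" for \<sigma>
  proof -
    have "\<sigma> \<in> sper_T A T" using \<sigma> sub(1) by (auto simp: sper_T_def)
    then have "\<sigma> g' = \<sigma> g" using eq unfolding hat_eq_iff by auto
    moreover have "0 \<le> \<sigma> ?c" using sper_T_nonneg[OF \<sigma> sub(2)] by auto
    ultimately show ?thesis using sper_T_value[OF \<sigma> g] g g'
      by (auto simp: sper_T_mult[OF \<sigma>] sper_T_neg[OF \<sigma>])
  qed
  then obtain n :: nat where n: "\<ominus> ((g \<otimes> g) [^] n) \<in> ?T'"
    using even_power_positivstellensatz[OF preorder_adjoin[OF T c] g] by blast
  obtain p u where p: "p \<in> T" and u: "u \<in> addspan A ((\<otimes>) ?c ` T)" "\<ominus> u \<in> (g \<otimes> g) [^] n \<oplus> p"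
    by (rule neg_mem_adjoin[OF T c _ n]) (use g in auto)
  have pA [simp]: "p \<in> carrier A" and uA: "u \<in> carrier A"
    using p preorder_carrier[OF T] u addspan_closed[OF scaled_closed[OF T c]] by auto
  have "u \<otimes> \<ominus> g \<in> addspan A ((\<otimes>) g' ` T)"
  proof (rule addspan_scale[OF scaled_closed[OF T c] _ _ scaled_closed[OF T g'] u(1)])
    show "\<ominus> g \<in> carrier A" using g by simp
    fix x assume "x \<in> (\<otimes>) ?c ` T"
    then obtain t where t: "t \<in> T" "x = ?c \<otimes> t" by blast
    then have "x \<otimes> \<ominus> g = g' \<otimes> ((g \<otimes> g) \<otimes> t)"
      using g g' preorder_carrier[OF T] by (simp add: neg_mult_left neg_mult_right m_ac)
    then show "x \<otimes> \<ominus> g \<in> addspan A ((\<otimes>) g' ` T)"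
      using addspan_superset[OF scaled_closed[OF T g']] preorder_mult[OF T] preorder_square[OF T g] t(1)
      by auto
  qed
  moreover have "\<ominus> u \<otimes> g \<in> (g \<otimes> g) [^] n \<otimes> g \<oplus> p \<otimes> g"
    using distrib[OF _ _ _ g u(2)] uA g by simp
  moreover have "u \<otimes> \<ominus> g = \<ominus> u \<otimes> g" using uA g by (simp add: neg_mult_left neg_mult_right)
  ultimately show thesis using that[OF p] m_comm[OF pA g] by simp
qed

text \<open>The previous lemma gives elements \<open>H\<close> and \<open>H'\<close> for \<open>(g, g')\<close> and for \<open>(g', g)\<close>. Any \<open>G \<in> H + H'\<close>
  inherits an odd power of \<open>g\<close> from \<open>H\<close> and an odd power of \<open>g'\<close> from \<open>H'\<close>, while the other summand
  contributes only multiples.\<close>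

lemma same_sign_common_multiple:
  assumes T: "preorder_of A T" and g: "g \<in> carrier A" and g': "g' \<in> carrier A"
    and eq: "hat A T g = hat A T g'"
  obtains G and n m :: nat and u v where
    "u \<in> addspan A ((\<otimes>) g ` T)" "G \<in> (g \<otimes> g) [^] n \<otimes> g \<oplus> u"
    "v \<in> addspan A ((\<otimes>) g' ` T)" "G \<in> (g' \<otimes> g') [^] m \<otimes> g' \<oplus> v"
proof -
  note TA = preorder_carrier[OF T] and sc = scaled_closed[OF T]
  obtain n :: nat and t H where H: "t \<in> T" "H \<in> (g \<otimes> g) [^] n \<otimes> g \<oplus> g \<otimes> t"
    "H \<in> addspan A ((\<otimes>) g' ` T)"
    by (rule same_sign_half_multiple[OF T g g' eq])
  obtain m :: nat and t' H' where H': "t' \<in> T" "H' \<in> (g' \<otimes> g') [^] m \<otimes> g' \<oplus> g' \<otimes> t'"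
    "H' \<in> addspan A ((\<otimes>) g ` T)"
    by (rule same_sign_half_multiple[OF T g' g eq[symmetric]])
  have [simp]: "t \<in> carrier A" "t' \<in> carrier A" using H H' TA by auto
  have HA: "H \<in> carrier A" "H' \<in> carrier A"
    using H(3) H'(3) addspan_closed[OF sc[OF g]] addspan_closed[OF sc[OF g']] by auto
  then obtain G where G: "G \<in> H \<oplus> H'" using add_nonempty by blast
  then have G': "G \<in> H' \<oplus> H" using HA add_comm[of H H'] by simp
  obtain u where u: "u \<in> g \<otimes> t \<oplus> H'" "G \<in> (g \<otimes> g) [^] n \<otimes> g \<oplus> u"
    by (rule add_assoc_right[OF H(2) G]) (use g HA in auto)
  obtain v where v: "v \<in> g' \<otimes> t' \<oplus> H" "G \<in> (g' \<otimes> g') [^] m \<otimes> g' \<oplus> v"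
    by (rule add_assoc_right[OF H'(2) G']) (use g' HA in auto)
  have "u \<in> addspan A ((\<otimes>) g ` T)" "v \<in> addspan A ((\<otimes>) g' ` T)"
    using addspan.add[OF _ H'(3) u(1)] addspan.add[OF _ H(3) v(1)] H(1) H'(1) by auto
  then show thesis using that u(2) v(2) by blast
qed

lemma sign_class_closed: "v \<in> sign_class A T x \<Longrightarrow> v \<in> carrier A"
  and sign_cone_closed: "v \<in> sign_cone A T x \<Longrightarrow> v \<in> carrier A"
  by (simp_all add: sign_class_def sign_cone_def)

lemma sign_cone_add:
  assumes u: "u \<in> sign_cone A T x" and v: "v \<in> sign_cone A T x" and w: "w \<in> u \<oplus> v"
  shows "w \<in> sign_cone A T x"
proof -
  have "\<sigma> w = 0 \<or> \<sigma> w = \<sigma> x" if \<sigma>: "\<sigma> \<in> sper_T A T" for \<sigma>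
  proof -
    have "\<sigma> u = 0 \<or> \<sigma> u = \<sigma> x" "\<sigma> v = 0 \<or> \<sigma> v = \<sigma> x"
      using u v \<sigma> by (auto simp: sign_cone_def)
    moreover have "\<sigma> w \<in> \<sigma> u \<oplus>\<^bsub>three\<^esub> \<sigma> v"
      using sper_T_add[OF \<sigma> w] u v by (simp add: sign_cone_closed)
    ultimately show ?thesis by (auto simp: three_add_eq split: if_splits)
  qed
  moreover have "w \<in> carrier A" using w u v sign_cone_closed by blast
  ultimately show ?thesis by (simp add: sign_cone_def)
qed

lemma sign_class_add:
  assumes u: "u \<in> sign_class A T x" and v: "v \<in> sign_cone A T x" and w: "w \<in> u \<oplus> v"
  shows "w \<in> sign_class A T x"
proof -
  have "\<sigma> w = \<sigma> x" if \<sigma>: "\<sigma> \<in> sper_T A T" for \<sigma>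
  proof -
    have "\<sigma> u = \<sigma> x" "\<sigma> v = 0 \<or> \<sigma> v = \<sigma> x"
      using u v \<sigma> by (auto simp: sign_cone_def sign_class_def)
    moreover have "\<sigma> w \<in> \<sigma> u \<oplus>\<^bsub>three\<^esub> \<sigma> v"
      using sper_T_add[OF \<sigma> w] u v by (simp add: sign_cone_closed sign_class_closed)
    ultimately show ?thesis by (auto simp: three_add_eq split: if_splits)
  qed
  moreover have "w \<in> carrier A" using w u v sign_cone_closed sign_class_closed by blast
  ultimately show ?thesis by (simp add: sign_class_def)
qed

text \<open>The signs of \<open>v\<close> are those of \<open>x\<close>. In \<open>(x + y)\<^sup>2 v\<close> the terms \<open>x\<^sup>2 v\<close> and \<open>y\<^sup>2 v\<close>
  have the sign of \<open>x\<close> or vanish, the first of them exactly where \<open>x\<close> does;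
  the mixed terms \<open>x y v\<close> have the sign of \<open>x\<^sup>2 y\<close>.\<close>

lemma square_times_sign_class:
  assumes g: "g \<in> x \<oplus> y" and x: "x \<in> carrier A" and y: "y \<in> carrier A" and v: "v \<in> sign_class A T x"
  obtains p q where "p \<in> sign_class A T x" "q \<in> sign_cone A T y" "(g \<otimes> g) \<otimes> v \<in> p \<oplus> q"
proof -
  have vA [simp]: "v \<in> carrier A" using v by (simp add: sign_class_def)
  have gA: "g \<in> carrier A" using g x y by blast
  have mem: "(x \<otimes> x) \<otimes> v \<in> sign_class A T x" "(x \<otimes> y) \<otimes> v \<in> sign_cone A T y"
    "(y \<otimes> x) \<otimes> v \<in> sign_cone A T y" "(y \<otimes> y) \<otimes> v \<in> sign_cone A T x"
  proof -
    have "\<sigma> (x \<otimes> x \<otimes> v) = \<sigma> x"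
      "\<sigma> (x \<otimes> y \<otimes> v) = 0 \<or> \<sigma> (x \<otimes> y \<otimes> v) = \<sigma> y"
      "\<sigma> (y \<otimes> x \<otimes> v) = 0 \<or> \<sigma> (y \<otimes> x \<otimes> v) = \<sigma> y"
      "\<sigma> (y \<otimes> y \<otimes> v) = 0 \<or> \<sigma> (y \<otimes> y \<otimes> v) = \<sigma> x"
      if \<sigma>: "\<sigma> \<in> sper_T A T" for \<sigma>
      using sper_T_value[OF \<sigma> x] sper_T_value[OF \<sigma> y] v x y \<sigma>
      by (auto simp: sign_class_def sper_T_mult[OF \<sigma>])
    then show "(x \<otimes> x) \<otimes> v \<in> sign_class A T x" "(x \<otimes> y) \<otimes> v \<in> sign_cone A T y"
      "(y \<otimes> x) \<otimes> v \<in> sign_cone A T y" "(y \<otimes> y) \<otimes> v \<in> sign_cone A T x"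
      using x y by (simp_all add: sign_class_def sign_cone_def)
  qed
  then have [simp]: "(x \<otimes> x) \<otimes> v \<in> carrier A" "(x \<otimes> y) \<otimes> v \<in> carrier A"
    "(y \<otimes> x) \<otimes> v \<in> carrier A" "(y \<otimes> y) \<otimes> v \<in> carrier A"
    using x y by simp_all
  obtain a b where a: "a \<in> x \<otimes> x \<oplus> x \<otimes> y" and b: "b \<in> y \<otimes> x \<oplus> y \<otimes> y" and ab: "g \<otimes> g \<in> a \<oplus> b"
    by (rule mult_add_add[OF g g x y x y])
  have [simp]: "a \<in> carrier A" "b \<in> carrier A" using a b x y by auto
  have "(g \<otimes> g) \<otimes> v \<in> a \<otimes> v \<oplus> b \<otimes> v" using distrib[OF _ _ _ vA ab] gA by simp
  moreover have "a \<otimes> v \<in> (x \<otimes> x) \<otimes> v \<oplus> (x \<otimes> y) \<otimes> v" using distrib[OF _ _ _ vA a] x y by simp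
  moreover have "b \<otimes> v \<in> (y \<otimes> y) \<otimes> v \<oplus> (y \<otimes> x) \<otimes> v"
    using distrib[OF _ _ _ vA b] x y add_comm[of "(y \<otimes> y) \<otimes> v" "(y \<otimes> x) \<otimes> v"] by simp
  ultimately obtain p q where "p \<in> (x \<otimes> x) \<otimes> v \<oplus> (y \<otimes> y) \<otimes> v" "q \<in> (x \<otimes> y) \<otimes> v \<oplus> (y \<otimes> x) \<otimes> v"
      "(g \<otimes> g) \<otimes> v \<in> p \<oplus> q"
    by (rule add_interchange) simp_all
  then show thesis using that sign_class_add sign_cone_add mem by blast
qed

lemma odd_power_splits:
  assumes g: "g \<in> x \<oplus> y" and x: "x \<in> carrier A" and y: "y \<in> carrier A"
  shows "\<exists>v\<in>sign_class A T x. \<exists>w\<in>sign_class A T y. (g \<otimes> g) [^] (n::nat) \<otimes> g \<in> v \<oplus> w"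
proof (induction n)
  have gA: "g \<in> carrier A" using g x y by blast
  case 0
  have "x \<in> sign_class A T x" "y \<in> sign_class A T y" using x y by (simp_all add: sign_class_def)
  then show ?case using g gA by auto
next
  case (Suc n)
  have gA: "g \<in> carrier A" using g x y by blast
  let ?u = "(g \<otimes> g) [^] n \<otimes> g"
  obtain v w where vw: "v \<in> sign_class A T x" "w \<in> sign_class A T y" "?u \<in> v \<oplus> w" using Suc by blast
  note [simp] = sign_class_closed[OF vw(1)] sign_class_closed[OF vw(2)]
  obtain p q where pq: "p \<in> sign_class A T x" "q \<in> sign_cone A T y" "(g \<otimes> g) \<otimes> v \<in> p \<oplus> q"
    by (rule square_times_sign_class[OF g x y vw(1)])
  have g': "g \<in> y \<oplus> x" using g x y add_comm[of x y] by simp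
  obtain r s where rs: "r \<in> sign_class A T y" "s \<in> sign_cone A T x" "(g \<otimes> g) \<otimes> w \<in> r \<oplus> s"
    by (rule square_times_sign_class[OF g' y x vw(2)])
  note [simp] = sign_class_closed[OF pq(1)] sign_cone_closed[OF pq(2)]
    sign_class_closed[OF rs(1)] sign_cone_closed[OF rs(2)]
  have "?u \<otimes> (g \<otimes> g) \<in> v \<otimes> (g \<otimes> g) \<oplus> w \<otimes> (g \<otimes> g)"
    using distrib[OF _ _ _ _ vw(3), of "g \<otimes> g"] gA by simp
  then have "(g \<otimes> g) [^] Suc n \<otimes> g \<in> (g \<otimes> g) \<otimes> v \<oplus> (g \<otimes> g) \<otimes> w"
    using gA by (simp add: m_comm[of _ "g \<otimes> g"]) (simp add: m_ac)
  moreover have "(g \<otimes> g) \<otimes> w \<in> s \<oplus> r" using rs(3) add_comm[of r s] by simp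
  ultimately obtain v' w' where "v' \<in> p \<oplus> s" "w' \<in> q \<oplus> r" "(g \<otimes> g) [^] Suc n \<otimes> g \<in> v' \<oplus> w'"
    using pq(3) by (elim add_interchange[of _ "(g \<otimes> g) \<otimes> v" "(g \<otimes> g) \<otimes> w" p q s r]) auto
  moreover have "q \<oplus> r = r \<oplus> q" by (rule add_comm) auto
  ultimately show ?case using sign_class_add[OF pq(1) rs(2)] sign_class_add[OF rs(1) pq(2)] by blast
qed

lemma multiples_split:
  assumes T: "preorder_of A T" and g: "g \<in> x \<oplus> y" and x: "x \<in> carrier A" and y: "y \<in> carrier A"
    and "u \<in> addspan A ((\<otimes>) g ` T)"
  shows "\<exists>v\<in>sign_cone A T x. \<exists>w\<in>sign_cone A T y. u \<in> v \<oplus> w"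
proof -
  have gA: "g \<in> carrier A" using g x y by blast
  let ?C = "{u \<in> carrier A. \<exists>v\<in>sign_cone A T x. \<exists>w\<in>sign_cone A T y. u \<in> v \<oplus> w}"
  have "addspan A ((\<otimes>) g ` T) \<subseteq> ?C"
  proof (rule addspan_least)
    show "(\<otimes>) g ` T \<subseteq> ?C"
    proof
      fix z assume "z \<in> (\<otimes>) g ` T"
      then obtain t where t: "t \<in> T" "z = g \<otimes> t" by blast
      have tA [simp]: "t \<in> carrier A" using t preorder_carrier[OF T] by blast
      have "x \<otimes> t \<in> sign_cone A T x" "y \<otimes> t \<in> sign_cone A T y"
        using x y t(1) by (auto simp: sign_cone_def sper_T_mult dest!: sper_T_nonneg[where T=T and a=t])
      moreover have "z \<in> x \<otimes> t \<oplus> y \<otimes> t" using distrib[OF gA x y tA g] t by simp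
      ultimately show "z \<in> ?C" using t gA by auto
    qed
    have "\<zero> \<in> sign_cone A T x" "\<zero> \<in> sign_cone A T y" by (simp_all add: sign_cone_def sper_T_zero)
    moreover have "\<zero> \<in> \<zero> \<oplus> \<zero>" by simp
    ultimately show "\<zero> \<in> ?C" by blast
    fix a b assume "a \<in> ?C" "b \<in> ?C"
    then obtain v w v' w' where vw: "v \<in> sign_cone A T x" "w \<in> sign_cone A T y" "a \<in> v \<oplus> w"
      "v' \<in> sign_cone A T x" "w' \<in> sign_cone A T y" "b \<in> v' \<oplus> w'" by blast
    show "a \<oplus> b \<subseteq> ?C"
    proof
      fix c assume c: "c \<in> a \<oplus> b"
      obtain p q where "p \<in> v \<oplus> v'" "q \<in> w \<oplus> w'" "c \<in> p \<oplus> q"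
        by (rule add_interchange[OF c vw(3,6)]) (use vw sign_cone_closed in auto)
      moreover have "c \<in> carrier A" using c \<open>a \<in> ?C\<close> \<open>b \<in> ?C\<close> by auto
      ultimately show "c \<in> ?C" using sign_cone_add vw by blast
    qed
  qed
  then show ?thesis using assms(5) by blast
qed

lemma odd_power_plus_multiples_split:
  assumes T: "preorder_of A T" and g: "g \<in> x \<oplus> y" and x: "x \<in> carrier A" and y: "y \<in> carrier A"
    and u: "u \<in> addspan A ((\<otimes>) g ` T)" and G: "G \<in> (g \<otimes> g) [^] (n::nat) \<otimes> g \<oplus> u"
  obtains v w where "v \<in> sign_class A T x" "w \<in> sign_class A T y" "G \<in> v \<oplus> w"
proof -
  obtain v w where vw: "v \<in> sign_class A T x" "w \<in> sign_class A T y" "(g \<otimes> g) [^] n \<otimes> g \<in> v \<oplus> w"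
    using odd_power_splits[OF g x y] by blast
  obtain p q where pq: "p \<in> sign_cone A T x" "q \<in> sign_cone A T y" "u \<in> p \<oplus> q"
    using multiples_split[OF T g x y u] by blast
  obtain v' w' where "v' \<in> v \<oplus> p" "w' \<in> w \<oplus> q" "G \<in> v' \<oplus> w'"
    by (rule add_interchange[OF G vw(3) pq(3)]) (use vw pq sign_class_closed sign_cone_closed in auto)
  then show thesis using that sign_class_add vw pq by blast
qed

text \<open>Associativity up to signs: the end result of the inner sum \<open>a + b\<close> only agrees with \<open>g'\<close> in signs,
  and all elements may be replaced by others of the same signs. Since \<open>g' \<in> x - c\<close>, the common
  element \<open>G\<close> for \<open>g\<close> and \<open>g'\<close> lies both in some \<open>a' + b'\<close> and in some \<open>x' - c'\<close>, whence
  \<open>x' \<in> (a' + b') + c'\<close>.\<close>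

lemma add_assoc_mod_sign:
  assumes T: "preorder_of A T"
    and A: "a \<in> carrier A" "b \<in> carrier A" "c \<in> carrier A" "g' \<in> carrier A"
    and g: "g \<in> a \<oplus> b" and eq: "hat A T g = hat A T g'" and x: "x \<in> g' \<oplus> c"
  obtains a' b' c' h x' where "a' \<in> sign_class A T a" "b' \<in> sign_class A T b" "c' \<in> sign_class A T c"
    "x' \<in> sign_class A T x" "h \<in> b' \<oplus> c'" "x' \<in> a' \<oplus> h"
proof -
  have gA: "g \<in> carrier A" and xA: "x \<in> carrier A" using g x A by blast+
  have nc: "\<ominus> c \<in> carrier A" using A by simp
  obtain G and n m :: nat and u v where
    u: "u \<in> addspan A ((\<otimes>) g ` T)" "G \<in> (g \<otimes> g) [^] n \<otimes> g \<oplus> u" and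
    v: "v \<in> addspan A ((\<otimes>) g' ` T)" "G \<in> (g' \<otimes> g') [^] m \<otimes> g' \<oplus> v"
    by (rule same_sign_common_multiple[OF T gA A(4) eq])
  obtain a' b' where ab: "a' \<in> sign_class A T a" "b' \<in> sign_class A T b" "G \<in> a' \<oplus> b'"
    by (rule odd_power_plus_multiples_split[OF T g A(1,2) u])
  have g': "g' \<in> x \<oplus> \<ominus> c" using add_solve_left[OF x] A by simp
  obtain x' y where xy: "x' \<in> sign_class A T x" "y \<in> sign_class A T (\<ominus> c)" "G \<in> x' \<oplus> y"
    by (rule odd_power_plus_multiples_split[OF T g' xA nc v])
  note [simp] = sign_class_closed[OF ab(1)] sign_class_closed[OF ab(2)]
    sign_class_closed[OF xy(1)] sign_class_closed[OF xy(2)]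
  have c': "\<ominus> y \<in> sign_class A T c" unfolding sign_class_def
  proof (intro CollectI conjI ballI)
    fix \<sigma> assume \<sigma>: "\<sigma> \<in> sper_T A T"
    then have "\<sigma> y = \<sigma> (\<ominus> c)" using xy(2) by (auto simp: sign_class_def)
    then show "\<sigma> (\<ominus> y) = \<sigma> c" using A by (simp add: sper_T_neg[OF \<sigma>])
  qed simp
  have "x' \<in> G \<oplus> \<ominus> y" using add_solve_left[OF xy(3)] by simp
  then obtain h where "h \<in> b' \<oplus> \<ominus> y" "x' \<in> a' \<oplus> h"
    by (rule add_assoc_right[OF ab(3)]) auto
  then show thesis using that ab(1,2) xy(1) c' by blast
qed

end

section \<open>Real reduced quotients and their universal property\<close>

lemma compose_apply: "a \<in> carrier A \<Longrightarrow> compose (carrier A) g f a = g (f a)"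
  by (simp add: compose_def)

lemma compose_eq_iff:
  "compose S g f = compose S g' f' \<longleftrightarrow> (\<forall>a\<in>S. g (f a) = g' (f' a))"
  by (auto simp: compose_def restrict_def fun_eq_iff)

lemma multi_homD:
  assumes "f \<in> multi_hom A B"
  shows multi_hom_extensional: "f \<in> extensional (carrier A)"
    and multi_hom_closed: "a \<in> carrier A \<Longrightarrow> f a \<in> carrier B"
    and multi_hom_add: "\<lbrakk>a \<in> b \<oplus>\<^bsub>A\<^esub> c; a \<in> carrier A; b \<in> carrier A; c \<in> carrier A\<rbrakk>
      \<Longrightarrow> f a \<in> f b \<oplus>\<^bsub>B\<^esub> f c"
    and multi_hom_mult: "\<lbrakk>a \<in> carrier A; b \<in> carrier A\<rbrakk> \<Longrightarrow> f (a \<otimes>\<^bsub>A\<^esub> b) = f a \<otimes>\<^bsub>B\<^esub> f b"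
    and multi_hom_zero: "f \<zero>\<^bsub>A\<^esub> = \<zero>\<^bsub>B\<^esub>"
    and multi_hom_one: "f \<one>\<^bsub>A\<^esub> = \<one>\<^bsub>B\<^esub>"
    and multi_hom_neg: "a \<in> carrier A \<Longrightarrow> f (\<ominus>\<^bsub>A\<^esub> a) = \<ominus>\<^bsub>B\<^esub> f a"
  using assms by (auto simp: multi_hom_def PiE_def)

lemma multi_homI:
  assumes "\<And>a. a \<in> carrier A \<Longrightarrow> f a \<in> carrier B" "f \<in> extensional (carrier A)"
    and "\<And>a b c. \<lbrakk>a \<in> carrier A; b \<in> carrier A; c \<in> carrier A; a \<in> b \<oplus>\<^bsub>A\<^esub> c\<rbrakk>
      \<Longrightarrow> f a \<in> f b \<oplus>\<^bsub>B\<^esub> f c"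
    and "\<And>a b. \<lbrakk>a \<in> carrier A; b \<in> carrier A\<rbrakk> \<Longrightarrow> f (a \<otimes>\<^bsub>A\<^esub> b) = f a \<otimes>\<^bsub>B\<^esub> f b"
    and "f \<zero>\<^bsub>A\<^esub> = \<zero>\<^bsub>B\<^esub>" "f \<one>\<^bsub>A\<^esub> = \<one>\<^bsub>B\<^esub>"
    and "\<And>a. a \<in> carrier A \<Longrightarrow> f (\<ominus>\<^bsub>A\<^esub> a) = \<ominus>\<^bsub>B\<^esub> f a"
  shows "f \<in> multi_hom A B"
  using assms by (simp add: multi_hom_def PiE_def Pi_def)

lemma id_multi_hom: "multiring A \<Longrightarrow> (\<lambda>a\<in>carrier A. a) \<in> multi_hom A A"
proof -
  assume "multiring A"
  then interpret multiring A .
  show ?thesis by (rule multi_homI) auto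
qed

lemma compose_multi_hom:
  assumes "multiring A" and f: "f \<in> multi_hom A B" and g: "g \<in> multi_hom B C"
  shows "compose (carrier A) g f \<in> multi_hom A C"
proof -
  interpret multiring A by fact
  note [simp] = multi_hom_closed[OF f] multi_hom_closed[OF g]
  show ?thesis
    by (rule multi_homI)
      (simp_all add: compose_apply multi_hom_mult[OF f] multi_hom_mult[OF g]
        multi_hom_neg[OF f] multi_hom_neg[OF g] multi_hom_zero[OF f] multi_hom_zero[OF g]
        multi_hom_one[OF f] multi_hom_one[OF g] multi_hom_add[OF f] multi_hom_add[OF g])
qed

lemma sper_T_pullback:
  assumes "multiring A" and f: "f \<in> p_hom A T B P" and \<tau>: "\<tau> \<in> sper_T B P" and T: "T \<subseteq> carrier A"
  shows "compose (carrier A) \<tau> f \<in> sper_T A T"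
proof -
  have "compose (carrier A) \<tau> f \<in> multi_hom A three"
    using compose_multi_hom[OF assms(1)] f \<tau> by (auto simp: p_hom_def sper_T_def sper_def)
  moreover have "compose (carrier A) \<tau> f t \<in> {0, 1}" if t: "t \<in> T" for t
  proof -
    have "f t \<in> P" using f t by (auto simp: p_hom_def)
    then have "\<tau> (f t) \<in> {0, 1}" using \<tau> unfolding sper_T_def by blast
    then show ?thesis using t T by (auto simp: compose_apply)
  qed
  ultimately show ?thesis unfolding sper_T_def sper_def by blast
qed

lemma p_hom_preserves_hat_eq:
  assumes A: "p_multiring A T" and f: "f \<in> p_hom A T B P"
    and a: "a \<in> carrier A" "b \<in> carrier A" and eq: "hat A T a = hat A T b"
  shows "hat B P (f a) = hat B P (f b)"
  unfolding hat_eq_iff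
proof
  fix \<tau> assume "\<tau> \<in> sper_T B P"
  then have "compose (carrier A) \<tau> f \<in> sper_T A T"
    using A f by (intro sper_T_pullback) (auto simp: p_multiring_def preorder_of_def)
  then have "compose (carrier A) \<tau> f a = compose (carrier A) \<tau> f b"
    using eq unfolding hat_eq_iff by blast
  then show "\<tau> (f a) = \<tau> (f b)" using a by (simp add: compose_apply)
qed

lemma (in multiring) sign_class_iff_hat_eq:
  "v \<in> sign_class A T x \<longleftrightarrow> v \<in> carrier A \<and> hat A T v = hat A T x"
  by (auto simp: sign_class_def hat_eq_iff)

lemma p_multiring_sper_T_nonempty:
  assumes "p_multiring A T"
  obtains \<sigma> where "\<sigma> \<in> sper_T A T"
proof -
  interpret multiring A using assms by (simp add: p_multiring_def)
  have "\<exists>\<sigma>. \<sigma> \<in> sper_T A T"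
  proof (rule ccontr)
    assume "\<nexists>\<sigma>. \<sigma> \<in> sper_T A T"
    then obtain n :: nat where "\<ominus>\<^bsub>A\<^esub> ((\<one>\<^bsub>A\<^esub> \<otimes>\<^bsub>A\<^esub> \<one>\<^bsub>A\<^esub>) [^]\<^bsub>A\<^esub> n) \<in> T"
      using even_power_positivstellensatz[of T "\<one>\<^bsub>A\<^esub>"] assms by (metis p_multiring_def one_closed)
    then show False using assms by (simp add: p_multiring_def)
  qed
  then show thesis using that by blast
qed

lemma multi_hom_sum_squares:
  assumes "multiring A" "multiring B" and f: "f \<in> multi_hom A B" and "x \<in> sum_squares A"
  shows "f x \<in> sum_squares B"
proof -
  interpret A: multiring A by fact
  interpret B: multiring B by fact
  have sqA: "squares A \<subseteq> carrier A" and sqB: "squares B \<subseteq> carrier B" by (auto simp: squares_def)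
  have sub: "addspan A (squares A) \<subseteq> carrier A" by (rule A.addspan_closed[OF sqA])
  have "x \<in> addspan A (squares A)" using assms(4) by (simp add: A.sum_squares_eq_addspan)
  then have "f x \<in> addspan B (squares B)"
  proof (induction rule: addspan.induct)
    case zero
    show ?case using f by (simp add: multi_hom_zero addspan.zero)
  next
    case (add x y z)
    then obtain a where a: "a \<in> carrier A" "x = a [^]\<^bsub>A\<^esub> (2::nat)" by (auto simp: squares_def)
    then have "f x = f a [^]\<^bsub>B\<^esub> (2::nat)"
      using f by (simp add: A.pow_two B.pow_two multi_hom_mult multi_hom_closed)
    then have "f x \<in> squares B" using multi_hom_closed[OF f a(1)] by (auto simp: squares_def)
    moreover have "x \<in> carrier A" "y \<in> carrier A" using a add sub by auto
    moreover have "z \<in> carrier A" using calculation add by blast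
    ultimately show ?case using add multi_hom_add[OF f] by (blast intro: addspan.add)
  qed
  then show ?thesis by (simp add: B.sum_squares_eq_addspan)
qed

lemma real_reduced_p_multiring: "real_reduced R \<Longrightarrow> p_multiring R (sum_squares R)"
  by (simp add: real_reduced_def p_multiring_def multiring.preorder_sum_squares)

text \<open>The elements \<open>x\<close> with \<open>g + x \<subseteq> {g}\<close> are closed under addition and contain all \<open>b\<^sup>2 g\<close>, so they contain
  all sums of elements \<open>g t\<close> with \<open>t\<close> a sum of squares. As \<open>g^(2n+1) = g\<close>, the common element of
  \<open>same_sign_common_multiple\<close> can only be \<open>g\<close>, and by symmetry only \<open>g'\<close>.\<close>

lemma real_reduced_separated:
  assumes R: "real_reduced R" and g: "g \<in> carrier R" and g': "g' \<in> carrier R"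
    and eq: "hat R (sum_squares R) g = hat R (sum_squares R) g'"
  shows "g = g'"
proof -
  interpret multiring R using R by (simp add: real_reduced_def)
  have sq: "squares R \<subseteq> carrier R" by (auto simp: squares_def)
  have absorb: "G = g"
    if g: "g \<in> carrier R" and u: "u \<in> addspan R ((\<otimes>\<^bsub>R\<^esub>) g ` sum_squares R)"
      and G: "G \<in> (g \<otimes>\<^bsub>R\<^esub> g) [^]\<^bsub>R\<^esub> n \<otimes>\<^bsub>R\<^esub> g \<oplus>\<^bsub>R\<^esub> u" for g u G and n :: nat
  proof -
    have cube: "g \<otimes>\<^bsub>R\<^esub> g \<otimes>\<^bsub>R\<^esub> g = g"
      using R g unfolding real_reduced_def by (simp add: numeral_3_eq_3)
    have "(g \<otimes>\<^bsub>R\<^esub> g) [^]\<^bsub>R\<^esub> n \<otimes>\<^bsub>R\<^esub> g = g"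
      by (induction n) (use g cube in \<open>simp_all add: m_assoc\<close>)
    then have Gu: "G \<in> g \<oplus>\<^bsub>R\<^esub> u" using G by simp
    let ?C = "{x \<in> carrier R. g \<oplus>\<^bsub>R\<^esub> x \<subseteq> {g}}"
    have C_add: "x \<oplus>\<^bsub>R\<^esub> y \<subseteq> ?C" if "x \<in> ?C" "y \<in> ?C" for x y
    proof
      fix z assume z: "z \<in> x \<oplus>\<^bsub>R\<^esub> y"
      have "w = g" if w: "w \<in> g \<oplus>\<^bsub>R\<^esub> z" for w
      proof -
        obtain k where "k \<in> g \<oplus>\<^bsub>R\<^esub> x" "w \<in> k \<oplus>\<^bsub>R\<^esub> y"
          by (rule add_assoc_left[OF z w]) (use g \<open>x \<in> ?C\<close> \<open>y \<in> ?C\<close> in auto)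
        then show ?thesis using \<open>x \<in> ?C\<close> \<open>y \<in> ?C\<close> by auto
      qed
      moreover have "z \<in> carrier R" using z that by blast
      ultimately show "z \<in> ?C" by blast
    qed
    have C_zero: "\<zero>\<^bsub>R\<^esub> \<in> ?C" using g by simp
    have "(\<otimes>\<^bsub>R\<^esub>) g ` squares R \<subseteq> ?C"
    proof
      fix x assume "x \<in> (\<otimes>\<^bsub>R\<^esub>) g ` squares R"
      then obtain b where b: "b \<in> carrier R" "x = b [^]\<^bsub>R\<^esub> (2::nat) \<otimes>\<^bsub>R\<^esub> g"
        using g m_comm by (auto simp: squares_def)
      then show "x \<in> ?C" using R g unfolding real_reduced_def by simp
    qed
    then have C_sq: "addspan R ((\<otimes>\<^bsub>R\<^esub>) g ` squares R) \<subseteq> ?C"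
      using C_add C_zero by (intro addspan_least)
    have gsq: "(\<otimes>\<^bsub>R\<^esub>) g ` squares R \<subseteq> carrier R" using sq g by auto
    have "(\<otimes>\<^bsub>R\<^esub>) g ` sum_squares R \<subseteq> ?C"
    proof
      fix x assume "x \<in> (\<otimes>\<^bsub>R\<^esub>) g ` sum_squares R"
      then obtain t where t: "t \<in> addspan R (squares R)" "x = g \<otimes>\<^bsub>R\<^esub> t"
        by (auto simp: sum_squares_eq_addspan)
      then have tR: "t \<in> carrier R" using addspan_closed[OF sq] by blast
      have "t \<otimes>\<^bsub>R\<^esub> g \<in> addspan R ((\<otimes>\<^bsub>R\<^esub>) g ` squares R)"
      proof (rule addspan_scale[OF sq g _ gsq t(1)])
        fix y assume "y \<in> squares R"
        then show "y \<otimes>\<^bsub>R\<^esub> g \<in> addspan R ((\<otimes>\<^bsub>R\<^esub>) g ` squares R)"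
          using addspan_superset[OF gsq] m_comm[of y g] g sq by auto
      qed
      then show "x \<in> ?C" using C_sq t(2) m_comm[OF g tR] by auto
    qed
    then have "addspan R ((\<otimes>\<^bsub>R\<^esub>) g ` sum_squares R) \<subseteq> ?C"
      using C_add C_zero by (intro addspan_least)
    then show ?thesis using u Gu by blast
  qed
  obtain G and n m :: nat and u v where
    "u \<in> addspan R ((\<otimes>\<^bsub>R\<^esub>) g ` sum_squares R)" "G \<in> (g \<otimes>\<^bsub>R\<^esub> g) [^]\<^bsub>R\<^esub> n \<otimes>\<^bsub>R\<^esub> g \<oplus>\<^bsub>R\<^esub> u"
    "v \<in> addspan R ((\<otimes>\<^bsub>R\<^esub>) g' ` sum_squares R)" "G \<in> (g' \<otimes>\<^bsub>R\<^esub> g') [^]\<^bsub>R\<^esub> m \<otimes>\<^bsub>R\<^esub> g' \<oplus>\<^bsub>R\<^esub> v"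
    by (rule same_sign_common_multiple[OF preorder_sum_squares g g' eq])
  then have "G = g" "G = g'" using absorb[OF g] absorb[OF g'] by blast+
  then show ?thesis by simp
qed

text \<open>A presentation of \<open>Q A T\<close> up to isomorphism, independent of its encoding by functions on signs.
  Since \<open>q\<close> is a morphism, the last assumption determines the sum of \<open>M\<close>.\<close>

locale reduction =
  fixes A :: "'a multiring" and T :: "'a set" and M :: "'b multiring" and q :: "'a \<Rightarrow> 'b"
  assumes p_mult: "p_multiring A T"
    and hom: "q \<in> multi_hom A M"
    and surj: "q ` carrier A = carrier M"
    and ker: "\<lbrakk>a \<in> carrier A; b \<in> carrier A\<rbrakk> \<Longrightarrow> q a = q b \<longleftrightarrow> hat A T a = hat A T b"
    and lift: "\<lbrakk>z \<in> q b \<oplus>\<^bsub>M\<^esub> q c; b \<in> carrier A; c \<in> carrier A\<rbrakk> \<Longrightarrow>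
      \<exists>a'\<in>carrier A. \<exists>b'\<in>carrier A. \<exists>c'\<in>carrier A. z = q a' \<and> q b' = q b \<and> q c' = q c \<and> a' \<in> b' \<oplus>\<^bsub>A\<^esub> c'"
begin

sublocale A: multiring A
  using p_mult by (simp add: p_multiring_def)

lemma preorder: "preorder_of A T"
  using p_mult by (simp add: p_multiring_def)

lemma representative:
  assumes "x \<in> carrier M"
  obtains a where "a \<in> carrier A" "x = q a"
  using assms surj by blast

lemma sum_representative:
  assumes "z \<in> x \<oplus>\<^bsub>M\<^esub> y" "x \<in> carrier M" "y \<in> carrier M"
  obtains a b c where "a \<in> carrier A" "b \<in> carrier A" "c \<in> carrier A"
    "z = q a" "x = q b" "y = q c" "a \<in> b \<oplus>\<^bsub>A\<^esub> c"
proof -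
  obtain b c where bc: "b \<in> carrier A" "x = q b" "c \<in> carrier A" "y = q c"
    using representative[OF assms(2)] representative[OF assms(3)] by metis
  then have "z \<in> q b \<oplus>\<^bsub>M\<^esub> q c" using assms(1) by simp
  from lift[OF this bc(1,3)] show thesis using that bc(2,4) by metis
qed

lemmas q_mult [symmetric] = multi_hom_mult[OF hom]
lemmas q_neg [symmetric] = multi_hom_neg[OF hom]
lemmas q_zero [symmetric] = multi_hom_zero[OF hom]
lemmas q_one [symmetric] = multi_hom_one[OF hom]

lemma q_closed [simp]: "a \<in> carrier A \<Longrightarrow> q a \<in> carrier M"
  by (rule multi_hom_closed[OF hom])

lemma q_add: "\<lbrakk>a \<in> b \<oplus>\<^bsub>A\<^esub> c; b \<in> carrier A; c \<in> carrier A\<rbrakk> \<Longrightarrow> q a \<in> q b \<oplus>\<^bsub>M\<^esub> q c"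
  using multi_hom_add[OF hom] A.add_closed by blast

lemma q_eqI:
  "\<lbrakk>a \<in> carrier A; b \<in> carrier A; \<And>\<sigma>. \<sigma> \<in> sper_T A T \<Longrightarrow> \<sigma> a = \<sigma> b\<rbrakk> \<Longrightarrow> q a = q b"
  by (simp add: ker hat_eq_iff)

lemma q_eqD: "\<lbrakk>q a = q b; a \<in> carrier A; b \<in> carrier A; \<sigma> \<in> sper_T A T\<rbrakk> \<Longrightarrow> \<sigma> a = \<sigma> b"
  unfolding ker hat_eq_iff by blast

text \<open>Signs are well defined on \<open>M\<close>, and each of them remains a morphism to \<open>three\<close> there; identities in
  \<open>M\<close> can therefore be checked in \<open>three\<close>.\<close>

lemma add_signs:
  assumes "z \<in> q b \<oplus>\<^bsub>M\<^esub> q c" and b: "b \<in> carrier A" and c: "c \<in> carrier A"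
  obtains a where "a \<in> carrier A" "z = q a"
    "\<And>\<sigma>. \<sigma> \<in> sper_T A T \<Longrightarrow> \<sigma> a \<in> \<sigma> b \<oplus>\<^bsub>three\<^esub> \<sigma> c"
proof -
  obtain a' b' c' where *: "a' \<in> carrier A" "b' \<in> carrier A" "c' \<in> carrier A"
    "z = q a'" "q b = q b'" "q c = q c'" "a' \<in> b' \<oplus>\<^bsub>A\<^esub> c'"
    by (rule sum_representative[OF assms(1)]) (use b c in auto)
  have "\<sigma> a' \<in> \<sigma> b \<oplus>\<^bsub>three\<^esub> \<sigma> c" if \<sigma>: "\<sigma> \<in> sper_T A T" for \<sigma>
    using A.sper_T_add[OF \<sigma> *(7,2,3)] q_eqD[OF *(5) b *(2) \<sigma>] q_eqD[OF *(6) c *(3) \<sigma>] by simp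
  then show thesis using that * by blast
qed

lemma multiring_quotient: "multiring M"
proof (intro multiring.intro comm_monoidI multiring_axioms.intro)
  show "\<one>\<^bsub>M\<^esub> \<in> carrier M" "\<zero>\<^bsub>M\<^esub> \<in> carrier M" by (simp_all add: q_one q_zero)
next
  fix x y assume x: "x \<in> carrier M" and y: "y \<in> carrier M"
  obtain a where a: "a \<in> carrier A" "x = q a" using x by (rule representative)
  obtain b where b: "b \<in> carrier A" "y = q b" using y by (rule representative)
  note ab = a b
  show "x \<otimes>\<^bsub>M\<^esub> y \<in> carrier M" "x \<otimes>\<^bsub>M\<^esub> y = y \<otimes>\<^bsub>M\<^esub> x"
    using ab A.m_comm by (simp_all add: q_mult)
  show "x \<oplus>\<^bsub>M\<^esub> y \<subseteq> carrier M"
  proof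
    fix z assume "z \<in> x \<oplus>\<^bsub>M\<^esub> y"
    then show "z \<in> carrier M" by (rule sum_representative) (use x y in auto)
  qed
  obtain c where "c \<in> a \<oplus>\<^bsub>A\<^esub> b" using A.add_nonempty ab by blast
  then show "x \<oplus>\<^bsub>M\<^esub> y \<noteq> {}" using q_add[of c a b] ab by auto
  have sub: "u \<oplus>\<^bsub>M\<^esub> v \<subseteq> v \<oplus>\<^bsub>M\<^esub> u" if u: "u \<in> carrier M" "v \<in> carrier M" for u v
  proof
    fix z assume "z \<in> u \<oplus>\<^bsub>M\<^esub> v"
    then obtain a b c where *: "a \<in> carrier A" "b \<in> carrier A" "c \<in> carrier A"
      "z = q a" "u = q b" "v = q c" "a \<in> b \<oplus>\<^bsub>A\<^esub> c" by (rule sum_representative[OF _ u])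
    then have "a \<in> c \<oplus>\<^bsub>A\<^esub> b" using A.add_comm[of b c] by simp
    then show "z \<in> v \<oplus>\<^bsub>M\<^esub> u" using q_add[of a c b] * by simp
  qed
  show "x \<oplus>\<^bsub>M\<^esub> y = y \<oplus>\<^bsub>M\<^esub> x" using sub[OF x y] sub[OF y x] by (rule subset_antisym)
  show "x \<in> y \<oplus>\<^bsub>M\<^esub> \<zero>\<^bsub>M\<^esub> \<longleftrightarrow> x = y"
  proof
    assume "x = y"
    then show "x \<in> y \<oplus>\<^bsub>M\<^esub> \<zero>\<^bsub>M\<^esub>" using q_add[of b b "\<zero>\<^bsub>A\<^esub>"] ab by (simp add: q_zero)
  next
    assume "x \<in> y \<oplus>\<^bsub>M\<^esub> \<zero>\<^bsub>M\<^esub>"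
    then have "x \<in> q b \<oplus>\<^bsub>M\<^esub> q \<zero>\<^bsub>A\<^esub>" using ab by (simp add: q_zero)
    then obtain c where c: "c \<in> carrier A" "x = q c"
      "\<And>\<sigma>. \<sigma> \<in> sper_T A T \<Longrightarrow> \<sigma> c \<in> \<sigma> b \<oplus>\<^bsub>three\<^esub> \<sigma> \<zero>\<^bsub>A\<^esub>"
      by (rule add_signs) (use ab in auto)
    have "q c = q b"
    proof (rule q_eqI)
      fix \<sigma> assume \<sigma>: "\<sigma> \<in> sper_T A T"
      show "\<sigma> c = \<sigma> b"
        using c(3)[OF \<sigma>] by (auto simp: three_add_eq A.sper_T_zero[OF \<sigma>] split: if_splits)
    qed (use c ab in auto)
    then show "x = y" using c ab by simp
  qed
next
  fix x assume "x \<in> carrier M"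
  then obtain a where a: "a \<in> carrier A" "x = q a" by (rule representative)
  show "\<one>\<^bsub>M\<^esub> \<otimes>\<^bsub>M\<^esub> x = x" "\<ominus>\<^bsub>M\<^esub> x \<in> carrier M" "x \<otimes>\<^bsub>M\<^esub> \<zero>\<^bsub>M\<^esub> = \<zero>\<^bsub>M\<^esub>"
    using a by (simp_all add: q_mult q_one q_neg q_zero A.mult_zero)
next
  fix x y z assume x: "x \<in> carrier M" and y: "y \<in> carrier M" and z: "z \<in> carrier M"
  obtain a where "a \<in> carrier A" "x = q a" using x by (rule representative)
  moreover obtain b where "b \<in> carrier A" "y = q b" using y by (rule representative)
  moreover obtain c where "c \<in> carrier A" "z = q c" using z by (rule representative)
  ultimately show "x \<otimes>\<^bsub>M\<^esub> y \<otimes>\<^bsub>M\<^esub> z = x \<otimes>\<^bsub>M\<^esub> (y \<otimes>\<^bsub>M\<^esub> z)"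
    by (simp add: q_mult A.m_assoc)
next
  fix x y z assume "x \<in> carrier M" and y: "y \<in> carrier M" and z: "z \<in> carrier M"
    and x: "x \<in> y \<oplus>\<^bsub>M\<^esub> z"
  obtain a b c where *: "a \<in> carrier A" "b \<in> carrier A" "c \<in> carrier A"
    "x = q a" "y = q b" "z = q c" "a \<in> b \<oplus>\<^bsub>A\<^esub> c" by (rule sum_representative[OF x y z])
  have "q c \<in> q (\<ominus>\<^bsub>A\<^esub> b) \<oplus>\<^bsub>M\<^esub> q a" "q b \<in> q a \<oplus>\<^bsub>M\<^esub> q (\<ominus>\<^bsub>A\<^esub> c)"
    using A.add_rev[OF *(1-3,7)] * by (auto intro!: q_add)
  then show "z \<in> (\<ominus>\<^bsub>M\<^esub> y) \<oplus>\<^bsub>M\<^esub> x \<and> y \<in> x \<oplus>\<^bsub>M\<^esub> (\<ominus>\<^bsub>M\<^esub> z)"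
    using * by (simp add: q_neg)
next
  fix x y z d assume "x \<in> carrier M" and y: "y \<in> carrier M" and z: "z \<in> carrier M"
    and d: "d \<in> carrier M" and x: "x \<in> y \<oplus>\<^bsub>M\<^esub> z"
  obtain a b c where *: "a \<in> carrier A" "b \<in> carrier A" "c \<in> carrier A"
    "x = q a" "y = q b" "z = q c" "a \<in> b \<oplus>\<^bsub>A\<^esub> c" by (rule sum_representative[OF x y z])
  obtain e where e: "e \<in> carrier A" "d = q e" using d by (rule representative)
  have "q (a \<otimes>\<^bsub>A\<^esub> e) \<in> q (b \<otimes>\<^bsub>A\<^esub> e) \<oplus>\<^bsub>M\<^esub> q (c \<otimes>\<^bsub>A\<^esub> e)"
    using A.distrib[OF *(1-3) e(1) *(7)] * e by (auto intro!: q_add)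
  then show "x \<otimes>\<^bsub>M\<^esub> d \<in> (y \<otimes>\<^bsub>M\<^esub> d) \<oplus>\<^bsub>M\<^esub> (z \<otimes>\<^bsub>M\<^esub> d)"
    using * e by (simp add: q_mult)
next
  fix x y z g w assume x: "x \<in> carrier M" and y: "y \<in> carrier M" and z: "z \<in> carrier M"
    and g: "g \<in> x \<oplus>\<^bsub>M\<^esub> y" and w: "w \<in> g \<oplus>\<^bsub>M\<^esub> z"
  obtain g1 a1 b1 where 1: "g1 \<in> carrier A" "a1 \<in> carrier A" "b1 \<in> carrier A"
    "g = q g1" "x = q a1" "y = q b1" "g1 \<in> a1 \<oplus>\<^bsub>A\<^esub> b1" by (rule sum_representative[OF g x y])
  have gM: "g \<in> carrier M" using 1 by simp
  obtain w2 g2 c2 where 2: "w2 \<in> carrier A" "g2 \<in> carrier A" "c2 \<in> carrier A"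
    "w = q w2" "g = q g2" "z = q c2" "w2 \<in> g2 \<oplus>\<^bsub>A\<^esub> c2" by (rule sum_representative[OF w gM z])
  have "hat A T g1 = hat A T g2" using ker[OF 1(1) 2(2)] 1(4) 2(5) by simp
  then obtain a' b' c' h w' where *: "a' \<in> sign_class A T a1" "b' \<in> sign_class A T b1"
    "c' \<in> sign_class A T c2" "w' \<in> sign_class A T w2" "h \<in> b' \<oplus>\<^bsub>A\<^esub> c'" "w' \<in> a' \<oplus>\<^bsub>A\<^esub> h"
    by (rule A.add_assoc_mod_sign[OF preorder 1(2,3) 2(3,2) 1(7) _ 2(7)])
  have cl: "q v = q u \<and> v \<in> carrier A" if "v \<in> sign_class A T u" "u \<in> carrier A" for v u
    using that ker by (simp add: A.sign_class_iff_hat_eq)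
  have C: "a' \<in> carrier A" "b' \<in> carrier A" "c' \<in> carrier A" and E: "q a' = x" "q b' = y" "q c' = z" "q w' = w"
    using cl[OF *(1) 1(2)] cl[OF *(2) 1(3)] cl[OF *(3) 2(3)] cl[OF *(4) 2(1)] 1 2 by simp_all
  have hA: "h \<in> carrier A" using *(5) C by blast
  have "q h \<in> y \<oplus>\<^bsub>M\<^esub> z" "w \<in> x \<oplus>\<^bsub>M\<^esub> q h"
    using q_add[OF *(5) C(2,3)] q_add[OF *(6) C(1) hA] E by simp_all
  then show "\<exists>h\<in>y \<oplus>\<^bsub>M\<^esub> z. w \<in> x \<oplus>\<^bsub>M\<^esub> h" by blast
qed

sublocale M: multiring M
  by (rule multiring_quotient)

lemma sum_squares_nonneg:
  assumes "x \<in> sum_squares M"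
  obtains a where "a \<in> carrier A" "x = q a" "\<And>\<sigma>. \<sigma> \<in> sper_T A T \<Longrightarrow> 0 \<le> \<sigma> a"
proof -
  \<comment> \<open>The images of elements without negative sign form an additively closed set containing all squares.\<close>
  let ?N = "{q a | a. a \<in> carrier A \<and> (\<forall>\<sigma>\<in>sper_T A T. 0 \<le> \<sigma> a)}"
  have "addspan M (squares M) \<subseteq> ?N"
  proof (rule M.addspan_least)
    show "squares M \<subseteq> ?N"
    proof
      fix y assume "y \<in> squares M"
      then obtain x where "x \<in> carrier M" "y = x \<otimes>\<^bsub>M\<^esub> x" by (auto simp: squares_def M.pow_two)
      then obtain a where "a \<in> carrier A" "y = q (a \<otimes>\<^bsub>A\<^esub> a)" by (metis representative q_mult)
      then show "y \<in> ?N" by (auto simp: A.sper_T_mult intro!: exI[of _ "a \<otimes>\<^bsub>A\<^esub> a"])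
    qed
    show "\<zero>\<^bsub>M\<^esub> \<in> ?N" by (auto simp: A.sper_T_zero q_zero intro!: exI[of _ "\<zero>\<^bsub>A\<^esub>"])
    fix x y assume "x \<in> ?N" "y \<in> ?N"
    then obtain a b where ab: "a \<in> carrier A" "b \<in> carrier A" "x = q a" "y = q b"
      and pos: "\<And>\<sigma>. \<sigma> \<in> sper_T A T \<Longrightarrow> 0 \<le> \<sigma> a" "\<And>\<sigma>. \<sigma> \<in> sper_T A T \<Longrightarrow> 0 \<le> \<sigma> b" by blast
    show "x \<oplus>\<^bsub>M\<^esub> y \<subseteq> ?N"
    proof
      fix z assume "z \<in> x \<oplus>\<^bsub>M\<^esub> y"
      then have "z \<in> q a \<oplus>\<^bsub>M\<^esub> q b" using ab by simp
      then obtain c where c: "c \<in> carrier A" "z = q c"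
        "\<And>\<sigma>. \<sigma> \<in> sper_T A T \<Longrightarrow> \<sigma> c \<in> \<sigma> a \<oplus>\<^bsub>three\<^esub> \<sigma> b"
        by (rule add_signs) (use ab in auto)
      have "0 \<le> \<sigma> c" if \<sigma>: "\<sigma> \<in> sper_T A T" for \<sigma>
        using c(3)[OF \<sigma>] pos[OF \<sigma>] A.sper_T_value[OF \<sigma> ab(1)] A.sper_T_value[OF \<sigma> ab(2)]
        by (auto simp: three_add_eq split: if_splits)
      then show "z \<in> ?N" using c by blast
    qed
  qed
  then show thesis using assms that by (auto simp: M.sum_squares_eq_addspan)
qed

lemma real_reduced_quotient: "real_reduced M"
  unfolding real_reduced_def
proof (intro conjI ballI)
  show "multiring M" by (rule multiring_quotient)
  show "\<ominus>\<^bsub>M\<^esub> \<one>\<^bsub>M\<^esub> \<notin> sum_squares M"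
  proof
    assume "\<ominus>\<^bsub>M\<^esub> \<one>\<^bsub>M\<^esub> \<in> sum_squares M"
    then obtain a where a: "a \<in> carrier A" "\<ominus>\<^bsub>M\<^esub> \<one>\<^bsub>M\<^esub> = q a" "\<And>\<sigma>. \<sigma> \<in> sper_T A T \<Longrightarrow> 0 \<le> \<sigma> a"
      by (rule sum_squares_nonneg) auto
    obtain \<sigma> where \<sigma>: "\<sigma> \<in> sper_T A T" using p_multiring_sper_T_nonempty[OF p_mult] .
    have "q (\<ominus>\<^bsub>A\<^esub> \<one>\<^bsub>A\<^esub>) = q a" using a(2) by (simp add: q_one q_neg)
    then have "\<sigma> (\<ominus>\<^bsub>A\<^esub> \<one>\<^bsub>A\<^esub>) = \<sigma> a" using a(1) \<sigma> by (intro q_eqD) auto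
    then show False using a(3)[OF \<sigma>] by (simp add: A.sper_T_neg[OF \<sigma>] A.sper_T_one[OF \<sigma>])
  qed
next
  fix x assume "x \<in> carrier M"
  then obtain a where a: "a \<in> carrier A" "x = q a" by (rule representative)
  have "q (a \<otimes>\<^bsub>A\<^esub> a \<otimes>\<^bsub>A\<^esub> a) = q a"
  proof (rule q_eqI)
    fix \<sigma> assume \<sigma>: "\<sigma> \<in> sper_T A T"
    show "\<sigma> (a \<otimes>\<^bsub>A\<^esub> a \<otimes>\<^bsub>A\<^esub> a) = \<sigma> a"
      using A.sper_T_value[OF \<sigma> a(1)] a by (auto simp: A.sper_T_mult[OF \<sigma>])
  qed (use a in auto)
  then show "x [^]\<^bsub>M\<^esub> (3::nat) = x" using a by (simp add: numeral_3_eq_3 q_mult)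
next
  fix x y assume "x \<in> carrier M" "y \<in> carrier M"
  then obtain a b where ab: "a \<in> carrier A" "b \<in> carrier A" "x = q a" "y = q b"
    by (metis representative)
  have eq1: "z = x" if "z \<in> x \<oplus>\<^bsub>M\<^esub> (y [^]\<^bsub>M\<^esub> (2::nat) \<otimes>\<^bsub>M\<^esub> x)" for z
  proof -
    have "z \<in> q a \<oplus>\<^bsub>M\<^esub> q (b \<otimes>\<^bsub>A\<^esub> b \<otimes>\<^bsub>A\<^esub> a)" using that ab by (simp add: M.pow_two q_mult)
    then obtain c where c: "c \<in> carrier A" "z = q c"
      "\<And>\<sigma>. \<sigma> \<in> sper_T A T \<Longrightarrow> \<sigma> c \<in> \<sigma> a \<oplus>\<^bsub>three\<^esub> \<sigma> (b \<otimes>\<^bsub>A\<^esub> b \<otimes>\<^bsub>A\<^esub> a)"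
      by (rule add_signs) (use ab in auto)
    have "q c = q a"
    proof (rule q_eqI)
      fix \<sigma> assume \<sigma>: "\<sigma> \<in> sper_T A T"
      show "\<sigma> c = \<sigma> a"
        using c(3)[OF \<sigma>] A.sper_T_value[OF \<sigma> ab(2)] ab
        by (auto simp: three_add_eq A.sper_T_mult[OF \<sigma>] split: if_splits)
    qed (use ab c in auto)
    then show ?thesis using c ab by simp
  qed
  have "x \<oplus>\<^bsub>M\<^esub> (y [^]\<^bsub>M\<^esub> (2::nat) \<otimes>\<^bsub>M\<^esub> x) \<noteq> {}" using ab by (intro M.add_nonempty) auto
  then show "x \<oplus>\<^bsub>M\<^esub> (y [^]\<^bsub>M\<^esub> (2::nat) \<otimes>\<^bsub>M\<^esub> x) = {x}" using eq1 by blast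
  have eq2: "z = z'"
    if "z \<in> x [^]\<^bsub>M\<^esub> (2::nat) \<oplus>\<^bsub>M\<^esub> y [^]\<^bsub>M\<^esub> (2::nat)" "z' \<in> x [^]\<^bsub>M\<^esub> (2::nat) \<oplus>\<^bsub>M\<^esub> y [^]\<^bsub>M\<^esub> (2::nat)" for z z'
  proof -
    have zz: "z \<in> q (a \<otimes>\<^bsub>A\<^esub> a) \<oplus>\<^bsub>M\<^esub> q (b \<otimes>\<^bsub>A\<^esub> b)" "z' \<in> q (a \<otimes>\<^bsub>A\<^esub> a) \<oplus>\<^bsub>M\<^esub> q (b \<otimes>\<^bsub>A\<^esub> b)"
      using that ab by (simp_all add: M.pow_two q_mult)
    obtain c where c: "c \<in> carrier A" "z = q c"
      "\<And>\<sigma>. \<sigma> \<in> sper_T A T \<Longrightarrow> \<sigma> c \<in> \<sigma> (a \<otimes>\<^bsub>A\<^esub> a) \<oplus>\<^bsub>three\<^esub> \<sigma> (b \<otimes>\<^bsub>A\<^esub> b)"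
      by (rule add_signs[OF zz(1)]) (use ab in auto)
    obtain c' where c': "c' \<in> carrier A" "z' = q c'"
      "\<And>\<sigma>. \<sigma> \<in> sper_T A T \<Longrightarrow> \<sigma> c' \<in> \<sigma> (a \<otimes>\<^bsub>A\<^esub> a) \<oplus>\<^bsub>three\<^esub> \<sigma> (b \<otimes>\<^bsub>A\<^esub> b)"
      by (rule add_signs[OF zz(2)]) (use ab in auto)
    have "q c = q c'"
    proof (rule q_eqI)
      fix \<sigma> assume \<sigma>: "\<sigma> \<in> sper_T A T"
      show "\<sigma> c = \<sigma> c'"
        using c(3)[OF \<sigma>] c'(3)[OF \<sigma>] A.sper_T_value[OF \<sigma> ab(1)] A.sper_T_value[OF \<sigma> ab(2)] ab
        by (auto simp: three_add_eq A.sper_T_mult[OF \<sigma>] split: if_splits)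
    qed (use c c' in auto)
    then show ?thesis using c c' by simp
  qed
  have "x [^]\<^bsub>M\<^esub> (2::nat) \<oplus>\<^bsub>M\<^esub> y [^]\<^bsub>M\<^esub> (2::nat) \<noteq> {}" using ab by (intro M.add_nonempty) auto
  then show "\<exists>z. x [^]\<^bsub>M\<^esub> (2::nat) \<oplus>\<^bsub>M\<^esub> y [^]\<^bsub>M\<^esub> (2::nat) = {z}" using eq2 by blast
qed

lemma hom_eqI:
  assumes "g \<in> multi_hom M N" "g' \<in> multi_hom M N" "\<And>a. a \<in> carrier A \<Longrightarrow> g (q a) = g' (q a)"
  shows "g = g'"
proof (rule extensionalityI[where A = "carrier M"])
  show "g \<in> extensional (carrier M)" "g' \<in> extensional (carrier M)"
    using assms(1,2) multi_hom_extensional by auto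
  fix x assume "x \<in> carrier M"
  then obtain a where "a \<in> carrier A" "x = q a" by (rule representative)
  then show "g x = g' x" using assms(3) by simp
qed

text \<open>A morphism that is constant on sign classes descends: sums in \<open>M\<close> are images of sums in \<open>A\<close>, so
  the induced map preserves them.\<close>

lemma factors_uniquely:
  assumes F: "F \<in> multi_hom A N"
    and resp: "\<And>a b. \<lbrakk>a \<in> carrier A; b \<in> carrier A; hat A T a = hat A T b\<rbrakk> \<Longrightarrow> F a = F b"
  shows "\<exists>!g. g \<in> multi_hom M N \<and> compose (carrier A) g q = F"
proof -
  define g where "g = (\<lambda>x\<in>carrier M. F (inv_into (carrier A) q x))"
  have gq: "g (q a) = F a" if a: "a \<in> carrier A" for a
  proof -
    have *: "inv_into (carrier A) q (q a) \<in> carrier A" "q (inv_into (carrier A) q (q a)) = q a"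
      using a by (auto intro: inv_into_into f_inv_into_f)
    then have "F (inv_into (carrier A) q (q a)) = F a"
      using ker[OF *(1) a] by (intro resp a) auto
    then show ?thesis using a by (simp add: g_def)
  qed
  have "g \<in> multi_hom M N"
  proof (rule multi_homI)
    show "g \<in> extensional (carrier M)" by (simp add: g_def)
    show "g \<zero>\<^bsub>M\<^esub> = \<zero>\<^bsub>N\<^esub>" "g \<one>\<^bsub>M\<^esub> = \<one>\<^bsub>N\<^esub>"
      by (simp_all add: q_zero q_one gq multi_hom_zero[OF F] multi_hom_one[OF F])
  next
    fix x assume "x \<in> carrier M"
    then obtain a where a: "a \<in> carrier A" "x = q a" by (rule representative)
    show "g x \<in> carrier N" "g (\<ominus>\<^bsub>M\<^esub> x) = \<ominus>\<^bsub>N\<^esub> g x"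
      using a by (simp_all add: gq q_neg multi_hom_closed[OF F] multi_hom_neg[OF F])
  next
    fix x y assume "x \<in> carrier M" "y \<in> carrier M"
    then obtain a b where ab: "a \<in> carrier A" "b \<in> carrier A" "x = q a" "y = q b"
      by (metis representative)
    then show "g (x \<otimes>\<^bsub>M\<^esub> y) = g x \<otimes>\<^bsub>N\<^esub> g y"
      by (simp add: gq q_mult multi_hom_mult[OF F])
  next
    fix z x y assume "x \<in> carrier M" "y \<in> carrier M" "z \<in> x \<oplus>\<^bsub>M\<^esub> y"
    then obtain a b c where *: "a \<in> carrier A" "b \<in> carrier A" "c \<in> carrier A"
      "z = q a" "x = q b" "y = q c" "a \<in> b \<oplus>\<^bsub>A\<^esub> c" using sum_representative by blast
    then show "g z \<in> g x \<oplus>\<^bsub>N\<^esub> g y" using multi_hom_add[OF F *(7,1,2,3)] by (simp add: gq)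
  qed
  moreover have "compose (carrier A) g q = F"
    by (rule extensionalityI[where A = "carrier A"])
      (auto simp: compose_apply gq multi_hom_extensional[OF F])
  ultimately show ?thesis
  proof (intro ex1I conjI)
    fix g' assume g': "g' \<in> multi_hom M N \<and> compose (carrier A) g' q = F"
    show "g' = g"
    proof (rule hom_eqI)
      show "g' \<in> multi_hom M N" "g \<in> multi_hom M N" using g' \<open>g \<in> multi_hom M N\<close> by simp_all
      show "g' (q a) = g (q a)" if "a \<in> carrier A" for a
        using gq[OF that] g' compose_apply[OF that, of g' q] by simp
    qed
  qed auto
qed

lemma real_reduced_universal:
  assumes R: "real_reduced R" and f: "f \<in> p_hom A T R (sum_squares R)"
  shows "\<exists>!g. g \<in> multi_hom M R \<and> compose (carrier A) g q = f"
proof (rule factors_uniquely)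
  show f': "f \<in> multi_hom A R" using f by (simp add: p_hom_def)
  show "f a = f b" if "a \<in> carrier A" "b \<in> carrier A" "hat A T a = hat A T b" for a b
    using real_reduced_separated[OF R] p_hom_preserves_hat_eq[OF p_mult f that] that multi_hom_closed[OF f']
    by blast
qed

text \<open>An element \<open>t\<close> of \<open>T\<close> has signs 0 and 1 only, the same as \<open>t\<^sup>2\<close>. Hence its image in \<open>R\<close> under a
  morphism that factors through \<open>M\<close> is a square.\<close>

lemma compose_p_hom:
  assumes R: "multiring R" and g: "g \<in> multi_hom M R"
  shows "compose (carrier A) g q \<in> p_hom A T R (sum_squares R)"
proof -
  interpret R: multiring R by fact
  have "compose (carrier A) g q t \<in> sum_squares R" if t: "t \<in> T" for t
  proof -
    have tA: "t \<in> carrier A" using A.preorder_carrier[OF preorder t] .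
    have "q t = q (t \<otimes>\<^bsub>A\<^esub> t)"
    proof (rule q_eqI)
      fix \<sigma> assume \<sigma>: "\<sigma> \<in> sper_T A T"
      show "\<sigma> t = \<sigma> (t \<otimes>\<^bsub>A\<^esub> t)"
        using A.sper_T_nonneg[OF \<sigma> t] tA by (auto simp: A.sper_T_mult[OF \<sigma>])
    qed (use tA in auto)
    then have "g (q t) = g (q t) \<otimes>\<^bsub>R\<^esub> g (q t)"
      using tA multi_hom_mult[OF g] multi_hom_mult[OF hom] by (metis q_closed)
    then show ?thesis
      using R.preorder_square[OF R.preorder_sum_squares, of "g (q t)"] multi_hom_closed[OF g] tA
      by (simp add: compose_apply)
  qed
  then show ?thesis using compose_multi_hom[OF A.multiring_axioms hom g] by (auto simp: p_hom_def)
qed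

lemma universal_bij:
  assumes R: "real_reduced R"
  shows "bij_betw (\<lambda>g. compose (carrier A) g q) (multi_hom M R) (p_hom A T R (sum_squares R))"
proof (rule bij_betwI')
  have mR: "multiring R" using R by (simp add: real_reduced_def)
  show "compose (carrier A) g q \<in> p_hom A T R (sum_squares R)" if "g \<in> multi_hom M R" for g
    using compose_p_hom[OF mR that] .
  show "\<exists>g\<in>multi_hom M R. f = compose (carrier A) g q" if "f \<in> p_hom A T R (sum_squares R)" for f
    using real_reduced_universal[OF R that] by blast
  show "compose (carrier A) g q = compose (carrier A) g' q \<longleftrightarrow> g = g'"
    if "g \<in> multi_hom M R" "g' \<in> multi_hom M R" for g g'
    using hom_eqI[OF that] by (auto simp: compose_eq_iff)
qed

end

section \<open>Functoriality and adjunction\<close>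

lemma reduction_proj:
  assumes "p_multiring A T"
  shows "reduction A T (Q A T) (proj A T)"
proof -
  interpret multiring A using assms by (simp add: p_multiring_def)
  have proj: "proj A T a = hat A T a" if "a \<in> carrier A" for a
    using that by (simp add: proj_def)
  have carr: "carrier (Q A T) = hat A T ` carrier A" by (simp add: Q_def)
  show ?thesis
  proof
    show "p_multiring A T" by fact
    show "proj A T \<in> multi_hom A (Q A T)"
    proof (rule multi_homI)
      show "proj A T \<in> extensional (carrier A)" by (simp add: proj_def)
      show "proj A T \<zero>\<^bsub>A\<^esub> = \<zero>\<^bsub>Q A T\<^esub>" "proj A T \<one>\<^bsub>A\<^esub> = \<one>\<^bsub>Q A T\<^esub>"
        by (simp_all add: proj Q_def)
      fix a assume a: "a \<in> carrier A"
      then show "proj A T a \<in> carrier (Q A T)" by (simp add: proj carr)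
      show "proj A T (\<ominus>\<^bsub>A\<^esub> a) = \<ominus>\<^bsub>Q A T\<^esub> proj A T a" using a by (simp add: proj Q_neg_hat)
      fix b assume b: "b \<in> carrier A"
      show "proj A T (a \<otimes>\<^bsub>A\<^esub> b) = proj A T a \<otimes>\<^bsub>Q A T\<^esub> proj A T b"
        using a b by (simp add: proj Q_mult_hat)
      fix c assume "c \<in> carrier A" "a \<in> b \<oplus>\<^bsub>A\<^esub> c"
      then show "proj A T a \<in> proj A T b \<oplus>\<^bsub>Q A T\<^esub> proj A T c"
        using a b by (auto simp: proj Q_def)
    qed
    show "proj A T ` carrier A = carrier (Q A T)" by (simp add: carr proj)
    show "proj A T a = proj A T b \<longleftrightarrow> hat A T a = hat A T b" if "a \<in> carrier A" "b \<in> carrier A" for a b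
      using that by (simp add: proj)
    fix z b c assume "z \<in> proj A T b \<oplus>\<^bsub>Q A T\<^esub> proj A T c" and b: "b \<in> carrier A" and c: "c \<in> carrier A"
    then have "\<exists>a'\<in>carrier A. \<exists>b'\<in>carrier A. \<exists>c'\<in>carrier A.
        hat A T a' = z \<and> hat A T b' = proj A T b \<and> hat A T c' = proj A T c \<and> a' \<in> b' \<oplus>\<^bsub>A\<^esub> c'"
      by (simp add: Q_def)
    then obtain a' b' c' where "a' \<in> carrier A" "b' \<in> carrier A" "c' \<in> carrier A"
        "hat A T a' = z" "hat A T b' = proj A T b" "hat A T c' = proj A T c" "a' \<in> b' \<oplus>\<^bsub>A\<^esub> c'"
      by blast
    then show "\<exists>a'\<in>carrier A. \<exists>b'\<in>carrier A. \<exists>c'\<in>carrier A. z = proj A T a' \<and>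
        proj A T b' = proj A T b \<and> proj A T c' = proj A T c \<and> a' \<in> b' \<oplus>\<^bsub>A\<^esub> c'"
      by (intro bexI[of _ a'] bexI[of _ b'] bexI[of _ c']) (simp_all add: proj)
  qed
qed

lemma (in reduction) reduction_copy:
  assumes inj: "inj_on h (carrier M)"
  shows "reduction A T (copy h M) (compose (carrier A) h q)"
proof -
  let ?q = "compose (carrier A) h q"
  have k [simp]: "inv_into (carrier M) h (h x) = x" if "x \<in> carrier M" for x
    using inj that by simp
  have hq: "?q a = h (q a)" if "a \<in> carrier A" for a using that by (rule compose_apply)
  have carr: "carrier (copy h M) = h ` carrier M"
    and zero: "\<zero>\<^bsub>copy h M\<^esub> = h \<zero>\<^bsub>M\<^esub>" and one: "\<one>\<^bsub>copy h M\<^esub> = h \<one>\<^bsub>M\<^esub>"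
    by (simp_all add: copy_def Let_def)
  have add: "h x \<oplus>\<^bsub>copy h M\<^esub> h y = h ` (x \<oplus>\<^bsub>M\<^esub> y)"
    and mult: "h x \<otimes>\<^bsub>copy h M\<^esub> h y = h (x \<otimes>\<^bsub>M\<^esub> y)"
    and neg: "\<ominus>\<^bsub>copy h M\<^esub> h x = h (\<ominus>\<^bsub>M\<^esub> x)"
    if "x \<in> carrier M" "y \<in> carrier M" for x y
    using that by (simp_all add: copy_def Let_def)
  show ?thesis
  proof
    show "p_multiring A T" by (rule p_mult)
    show "?q \<in> multi_hom A (copy h M)"
    proof (rule multi_homI)
      show "?q \<in> extensional (carrier A)" by simp
      show "?q \<zero>\<^bsub>A\<^esub> = \<zero>\<^bsub>copy h M\<^esub>" "?q \<one>\<^bsub>A\<^esub> = \<one>\<^bsub>copy h M\<^esub>"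
        by (simp_all add: hq zero one q_zero q_one)
      fix a assume a: "a \<in> carrier A"
      then show "?q a \<in> carrier (copy h M)" by (simp add: hq carr)
      show "?q (\<ominus>\<^bsub>A\<^esub> a) = \<ominus>\<^bsub>copy h M\<^esub> ?q a" using a neg[of "q a" "q a"] by (simp add: hq q_neg)
      fix b assume b: "b \<in> carrier A"
      show "?q (a \<otimes>\<^bsub>A\<^esub> b) = ?q a \<otimes>\<^bsub>copy h M\<^esub> ?q b" using a b mult by (simp add: hq q_mult)
      fix c assume "c \<in> carrier A" "a \<in> b \<oplus>\<^bsub>A\<^esub> c"
      then show "?q a \<in> ?q b \<oplus>\<^bsub>copy h M\<^esub> ?q c" using a b add q_add by (simp add: hq)
    qed
    show "?q ` carrier A = carrier (copy h M)"
      unfolding carr surj[symmetric] by (auto simp: hq image_iff)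
    show "?q a = ?q b \<longleftrightarrow> hat A T a = hat A T b" if "a \<in> carrier A" "b \<in> carrier A" for a b
      using that inj ker by (simp add: hq inj_on_eq_iff)
    fix z b c assume "z \<in> ?q b \<oplus>\<^bsub>copy h M\<^esub> ?q c" and b: "b \<in> carrier A" and c: "c \<in> carrier A"
    then obtain y where y: "z = h y" "y \<in> q b \<oplus>\<^bsub>M\<^esub> q c" using add by (auto simp: hq)
    obtain a' b' c' where *: "a' \<in> carrier A" "b' \<in> carrier A" "c' \<in> carrier A"
      "y = q a'" "q b = q b'" "q c = q c'" "a' \<in> b' \<oplus>\<^bsub>A\<^esub> c'"
      by (rule sum_representative[OF y(2)]) (use b c in auto)
    then show "\<exists>a'\<in>carrier A. \<exists>b'\<in>carrier A. \<exists>c'\<in>carrier A.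
        z = ?q a' \<and> ?q b' = ?q b \<and> ?q c' = ?q c \<and> a' \<in> b' \<oplus>\<^bsub>A\<^esub> c'"
      using y b c by (intro bexI[of _ a'] bexI[of _ b'] bexI[of _ c']) (simp_all add: hq)
  qed
qed

lemma reduction_map_ex1:
  assumes M: "reduction A T M q" and N: "reduction B P N r" and f: "f \<in> p_hom A T B P"
  shows "\<exists>!g. g \<in> multi_hom M N \<and> compose (carrier A) g q = compose (carrier A) r f"
proof -
  interpret M: reduction A T M q by fact
  interpret N: reduction B P N r by fact
  have f': "f \<in> multi_hom A B" using f by (simp add: p_hom_def)
  show ?thesis
  proof (rule M.factors_uniquely)
    show "compose (carrier A) r f \<in> multi_hom A N"
      by (rule compose_multi_hom[OF M.A.multiring_axioms f' N.hom])
    fix a b assume ab: "a \<in> carrier A" "b \<in> carrier A" "hat A T a = hat A T b"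
    then have "hat B P (f a) = hat B P (f b)" by (rule p_hom_preserves_hat_eq[OF M.p_mult f])
    then show "compose (carrier A) r f a = compose (carrier A) r f b"
      using ab N.ker multi_hom_closed[OF f'] by (simp add: compose_apply)
  qed
qed

lemma Q_map_hom:
  assumes "p_multiring A T" "p_multiring B P" "f \<in> p_hom A T B P"
  shows "Q_map A T B P f \<in> multi_hom (Q A T) (Q B P)"
    and "a \<in> carrier A \<Longrightarrow> Q_map A T B P f (proj A T a) = proj B P (f a)"
proof -
  have "Q_map A T B P f \<in> multi_hom (Q A T) (Q B P) \<and>
     compose (carrier A) (Q_map A T B P f) (proj A T) = compose (carrier A) (proj B P) f"
    unfolding Q_map_def by (rule theI'[OF reduction_map_ex1]) (use assms reduction_proj in auto)
  then show "Q_map A T B P f \<in> multi_hom (Q A T) (Q B P)"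
    and "a \<in> carrier A \<Longrightarrow> Q_map A T B P f (proj A T a) = proj B P (f a)"
    by (simp_all add: compose_eq_iff)
qed

lemma category_pMulti: "category (pMulti :: ('a multiring \<times> 'a set, 'a \<Rightarrow> 'a) cat)"
proof -
  have comp: "compose (carrier A) g f \<in> p_hom A T C S"
    if "p_multiring A T" "f \<in> p_hom A T B P" "g \<in> p_hom B P C S"
    for A B C :: "'a multiring" and T P S f g
  proof -
    have "compose (carrier A) g f \<in> multi_hom A C"
      using that by (intro compose_multi_hom) (auto simp: p_hom_def p_multiring_def)
    moreover have "compose (carrier A) g f t \<in> S" if "t \<in> T" for t
    proof -
      have "t \<in> carrier A"
        using that \<open>p_multiring A T\<close> by (auto simp: p_multiring_def preorder_of_def)
      moreover have "f t \<in> P" using that \<open>f \<in> p_hom A T B P\<close> by (auto simp: p_hom_def)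
      then have "g (f t) \<in> S" using \<open>g \<in> p_hom B P C S\<close> by (auto simp: p_hom_def)
      ultimately show ?thesis by (simp add: compose_apply)
    qed
    ultimately show ?thesis by (auto simp: p_hom_def)
  qed
  have ident: "(\<lambda>a\<in>carrier A. a) \<in> p_hom A T A T" if "p_multiring A T" for A :: "'a multiring" and T
  proof -
    have "T \<subseteq> carrier A" using that by (simp add: p_multiring_def preorder_of_def)
    then show ?thesis using that id_multi_hom[of A] by (auto simp: p_hom_def p_multiring_def)
  qed
  have maps: "f \<in> carrier A \<rightarrow> carrier B" "f \<in> extensional (carrier A)"
    if "f \<in> p_hom A T B P" for f and A B :: "'a multiring" and T P
    using that by (auto simp: p_hom_def multi_hom_def PiE_def)
  show ?thesis
  proof
    fix x y z w :: "'a multiring \<times> 'a set" and f g h :: "'a \<Rightarrow> 'a"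
    obtain A T where x: "x = (A, T)" by (cases x)
    obtain B P where y: "y = (B, P)" by (cases y)
    obtain C S where z: "z = (C, S)" by (cases z)
    obtain D U where w: "w = (D, U)" by (cases w)
    note xyz = x y z w pMulti_def
    show "Id pMulti x \<in> Hom pMulti x x" if "x \<in> Ob pMulti"
      using that ident by (simp add: xyz)
    show "Comp pMulti x y z g f \<in> Hom pMulti x z"
      if "x \<in> Ob pMulti" "y \<in> Ob pMulti" "z \<in> Ob pMulti" "f \<in> Hom pMulti x y" "g \<in> Hom pMulti y z"
      using that comp by (simp add: xyz)
    show "Comp pMulti x y y (Id pMulti y) f = f"
      if "x \<in> Ob pMulti" "y \<in> Ob pMulti" "f \<in> Hom pMulti x y"
      using that maps[of f A T B P] by (simp add: xyz Id_compose)
    show "Comp pMulti x x y f (Id pMulti x) = f"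
      if "x \<in> Ob pMulti" "y \<in> Ob pMulti" "f \<in> Hom pMulti x y"
      using that maps[of f A T B P] by (simp add: xyz compose_Id)
    show "Comp pMulti w y z h (Comp pMulti w x y g f) = Comp pMulti w x z (Comp pMulti x y z h g) f"
      if "w \<in> Ob pMulti" "x \<in> Ob pMulti" "y \<in> Ob pMulti" "z \<in> Ob pMulti"
        "f \<in> Hom pMulti w x" "g \<in> Hom pMulti x y" "h \<in> Hom pMulti y z"
      using that maps[of f D U A T] by (simp add: xyz compose_assoc)
  qed
qed

lemma category_RRM: "category (RRM :: ('a multiring, 'a \<Rightarrow> 'a) cat)"
proof -
  have maps: "f \<in> carrier A \<rightarrow> carrier B" "f \<in> extensional (carrier A)"
    if "f \<in> multi_hom A B" for f and A B :: "'a multiring"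
    using that by (auto simp: multi_hom_def PiE_def)
  show ?thesis
    by unfold_locales
      (auto simp: RRM_def real_reduced_def id_multi_hom compose_multi_hom compose_assoc[OF maps(1)]
        Id_compose[OF maps] compose_Id[OF maps])
qed

text \<open>The two functors of interest take values over different types of elements. Both are determined
  by unit maps \<open>\<eta>\<close> onto reductions and by naturality of \<open>\<eta>\<close>; preservation of identities and
  composites then follows since \<open>\<eta>\<close> is surjective.\<close>

lemma reduction_functor:
  fixes Fo :: "'a multiring \<times> 'a set \<Rightarrow> 'b multiring"
    and Fm :: "'a multiring \<times> 'a set \<Rightarrow> 'a multiring \<times> 'a set \<Rightarrow> ('a \<Rightarrow> 'a) \<Rightarrow> ('b \<Rightarrow> 'b)"
    and \<eta> :: "'a multiring \<Rightarrow> 'a set \<Rightarrow> 'a \<Rightarrow> 'b"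
  assumes red: "\<And>A T. p_multiring A T \<Longrightarrow> reduction A T (Fo (A, T)) (\<eta> A T)"
    and Fm: "\<And>A T B P f. \<lbrakk>p_multiring A T; p_multiring B P; f \<in> p_hom A T B P\<rbrakk> \<Longrightarrow>
      Fm (A, T) (B, P) f \<in> multi_hom (Fo (A, T)) (Fo (B, P))"
    and nat: "\<And>A T B P f a. \<lbrakk>p_multiring A T; p_multiring B P; f \<in> p_hom A T B P; a \<in> carrier A\<rbrakk> \<Longrightarrow>
      Fm (A, T) (B, P) f (\<eta> A T a) = \<eta> B P (f a)"
  shows "cat_functor pMulti RRM Fo Fm"
proof -
  interpret pM: category "pMulti :: ('a multiring \<times> 'a set, 'a \<Rightarrow> 'a) cat" by (rule category_pMulti)
  interpret RM: category "RRM :: ('b multiring, 'b \<Rightarrow> 'b) cat" by (rule category_RRM)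
  show ?thesis
  proof
    fix x y z :: "'a multiring \<times> 'a set" and f g :: "'a \<Rightarrow> 'a"
    obtain A T where x: "x = (A, T)" by (cases x)
    obtain B P where y: "y = (B, P)" by (cases y)
    obtain C S where z: "z = (C, S)" by (cases z)
    note xyz = x y z pMulti_def RRM_def
    assume "x \<in> Ob pMulti"
    then have A: "p_multiring A T" by (simp add: xyz)
    interpret M: reduction A T "Fo (A, T)" "\<eta> A T" by (rule red[OF A])
    show "Fo x \<in> Ob RRM" using M.real_reduced_quotient by (simp add: xyz)
    show "Fm x x (Id pMulti x) = Id RRM (Fo x)"
    proof -
      have id: "(\<lambda>a\<in>carrier A. a) \<in> p_hom A T A T" using pM.Id_in[of x] A by (simp add: xyz)
      have "Fm (A, T) (A, T) (\<lambda>a\<in>carrier A. a) = (\<lambda>a\<in>carrier (Fo (A, T)). a)"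
        by (rule M.hom_eqI[OF Fm[OF A A id] id_multi_hom[OF M.multiring_quotient]])
          (simp add: nat[OF A A id])
      then show ?thesis by (simp add: xyz)
    qed
    assume "y \<in> Ob pMulti" "f \<in> Hom pMulti x y"
    then have B: "p_multiring B P" and f: "f \<in> p_hom A T B P" by (simp_all add: xyz)
    show "Fm x y f \<in> Hom RRM (Fo x) (Fo y)" using Fm[OF A B f] by (simp add: xyz)
    assume "z \<in> Ob pMulti" "g \<in> Hom pMulti y z"
    then have C: "p_multiring C S" and g: "g \<in> p_hom B P C S" by (simp_all add: xyz)
    have gf: "compose (carrier A) g f \<in> p_hom A T C S"
      using pM.Comp_in[of x y z f g] A B C f g by (simp add: xyz)
    have "Fm (A, T) (C, S) (compose (carrier A) g f) =
        compose (carrier (Fo (A, T))) (Fm (B, P) (C, S) g) (Fm (A, T) (B, P) f)"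
    proof (rule M.hom_eqI[OF Fm[OF A C gf]])
      show "compose (carrier (Fo (A, T))) (Fm (B, P) (C, S) g) (Fm (A, T) (B, P) f)
          \<in> multi_hom (Fo (A, T)) (Fo (C, S))"
        by (rule compose_multi_hom[OF M.multiring_quotient Fm[OF A B f] Fm[OF B C g]])
      fix a assume a: "a \<in> carrier A"
      have "f a \<in> carrier B" using f a multi_hom_closed[of f A B a] by (simp add: p_hom_def)
      then show "Fm (A, T) (C, S) (compose (carrier A) g f) (\<eta> A T a) =
          compose (carrier (Fo (A, T))) (Fm (B, P) (C, S) g) (Fm (A, T) (B, P) f) (\<eta> A T a)"
        using a by (simp add: nat[OF A C gf] nat[OF A B f] nat[OF B C g] compose_apply)
    qed
    then show "Fm x z (Comp pMulti x y z g f) = Comp RRM (Fo x) (Fo y) (Fo z) (Fm y z g) (Fm x y f)"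
      by (simp add: xyz)
  qed
qed

lemma inclusion_functor: "cat_functor RRM pMulti incl_ob incl_map"
proof -
  interpret pM: category "pMulti :: ('a multiring \<times> 'a set, 'a \<Rightarrow> 'a) cat" by (rule category_pMulti)
  interpret RM: category "RRM :: ('a multiring, 'a \<Rightarrow> 'a) cat" by (rule category_RRM)
  show ?thesis
  proof
    fix R S U :: "'a multiring" and f g :: "'a \<Rightarrow> 'a"
    assume "R \<in> Ob RRM"
    then have R: "real_reduced R" by (simp add: RRM_def)
    then show "incl_ob R \<in> Ob pMulti"
      by (simp add: incl_ob_def pMulti_def real_reduced_p_multiring)
    show "incl_map R R (Id RRM R) = Id pMulti (incl_ob R)"
      by (simp add: incl_map_def incl_ob_def RRM_def pMulti_def)
    assume "S \<in> Ob RRM" "f \<in> Hom RRM R S"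
    then have "real_reduced S" "f \<in> multi_hom R S" by (simp_all add: RRM_def)
    then have "f \<in> p_hom R (sum_squares R) S (sum_squares S)"
      using R multi_hom_sum_squares[of R S f] by (auto simp: p_hom_def real_reduced_def)
    then show "incl_map R S f \<in> Hom pMulti (incl_ob R) (incl_ob S)"
      by (simp add: incl_map_def incl_ob_def pMulti_def)
    show "incl_map R U (Comp RRM R S U g f) =
        Comp pMulti (incl_ob R) (incl_ob S) (incl_ob U) (incl_map S U g) (incl_map R S f)"
      by (simp add: incl_map_def incl_ob_def RRM_def pMulti_def)
  qed
qed

lemma reduction_left_adjoint:
  fixes Fo :: "'a multiring \<times> 'a set \<Rightarrow> 'a multiring"
    and Fm :: "'a multiring \<times> 'a set \<Rightarrow> 'a multiring \<times> 'a set \<Rightarrow> ('a \<Rightarrow> 'a) \<Rightarrow> ('a \<Rightarrow> 'a)"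
    and \<eta> :: "'a multiring \<Rightarrow> 'a set \<Rightarrow> 'a \<Rightarrow> 'a"
  assumes red: "\<And>A T. p_multiring A T \<Longrightarrow> reduction A T (Fo (A, T)) (\<eta> A T)"
    and Fm: "\<And>A T B P f. \<lbrakk>p_multiring A T; p_multiring B P; f \<in> p_hom A T B P\<rbrakk> \<Longrightarrow>
      Fm (A, T) (B, P) f \<in> multi_hom (Fo (A, T)) (Fo (B, P))"
    and nat: "\<And>A T B P f a. \<lbrakk>p_multiring A T; p_multiring B P; f \<in> p_hom A T B P; a \<in> carrier A\<rbrakk> \<Longrightarrow>
      Fm (A, T) (B, P) f (\<eta> A T a) = \<eta> B P (f a)"
  shows "left_adjoint pMulti RRM Fo Fm incl_ob incl_map"
  unfolding left_adjoint_def
proof (intro conjI)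
  show "cat_functor pMulti RRM Fo Fm" by (rule reduction_functor[OF red Fm nat])
  show "cat_functor RRM pMulti incl_ob (incl_map :: 'a multiring \<Rightarrow> _)" by (rule inclusion_functor)
  define \<Phi> :: "'a multiring \<times> 'a set \<Rightarrow> 'a multiring \<Rightarrow> ('a \<Rightarrow> 'a) \<Rightarrow> 'a \<Rightarrow> 'a"
    where "\<Phi> = (\<lambda>(A, T) R g. compose (carrier A) g (\<eta> A T))"
  have "bij_betw (\<Phi> c d) (Hom RRM (Fo c) d) (Hom pMulti c (incl_ob d))"
    if "c \<in> Ob pMulti" "d \<in> Ob RRM" for c d
  proof -
    obtain A T where c: "c = (A, T)" by (cases c)
    interpret reduction A T "Fo (A, T)" "\<eta> A T" using that by (intro red) (simp add: c pMulti_def)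
    show ?thesis using universal_bij[of d] that by (simp add: \<Phi>_def c pMulti_def RRM_def incl_ob_def)
  qed
  moreover have "\<Phi> c' d' (Comp RRM (Fo c') d d' v (Comp RRM (Fo c') (Fo c) d g (Fm c' c u))) =
      Comp pMulti c' (incl_ob d) (incl_ob d') (incl_map d d' v)
        (Comp pMulti c' c (incl_ob d) (\<Phi> c d g) u)"
    if "c \<in> Ob pMulti" "c' \<in> Ob pMulti" "u \<in> Hom pMulti c' c" for c c' d d' u v g
  proof -
    obtain A T where c: "c = (A, T)" by (cases c)
    obtain A' T' where c': "c' = (A', T')" by (cases c')
    have A: "p_multiring A T" "p_multiring A' T'" and u: "u \<in> p_hom A' T' A T"
      using that by (simp_all add: c c' pMulti_def)
    interpret reduction A' T' "Fo (A', T')" "\<eta> A' T'" by (rule red[OF A(2)])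
    have "u a \<in> carrier A" if "a \<in> carrier A'" for a
      using u that multi_hom_closed[of u A' A a] by (simp add: p_hom_def)
    then show ?thesis
      by (simp add: \<Phi>_def c c' pMulti_def RRM_def incl_ob_def incl_map_def compose_eq_iff
          compose_apply nat[OF A(2,1) u])
  qed
  ultimately show "\<exists>\<Phi>. (\<forall>c\<in>Ob pMulti. \<forall>d\<in>Ob RRM. bij_betw (\<Phi> c d) (Hom RRM (Fo c) d) (Hom pMulti c (incl_ob d))) \<and>
     (\<forall>c\<in>Ob pMulti. \<forall>c'\<in>Ob pMulti. \<forall>d\<in>Ob RRM. \<forall>d'\<in>Ob RRM.
       \<forall>u\<in>Hom pMulti c' c. \<forall>v\<in>Hom RRM d d'. \<forall>g\<in>Hom RRM (Fo c) d.
         \<Phi> c' d' (Comp RRM (Fo c') d d' v (Comp RRM (Fo c') (Fo c) d g (Fm c' c u))) =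
         Comp pMulti c' (incl_ob d) (incl_ob d') (incl_map d d' v)
           (Comp pMulti c' c (incl_ob d) (\<Phi> c d g) u))"
    by blast
qed

lemma Q_copy_reduction:
  assumes "relabelling e" "p_multiring A T"
  shows "reduction A T (Q_copy_ob e (A, T)) (compose (carrier A) (e A T) (proj A T))"
proof -
  have "inj_on (e A T) (carrier (Q A T))" using assms by (simp add: relabelling_def)
  then show ?thesis
    using reduction.reduction_copy[OF reduction_proj[OF assms(2)]] by (simp add: Q_copy_ob_def)
qed

text \<open>The conjugate of \<open>Q_map\<close> by the relabellings agrees on the image of the unit with the
  morphism between the copies given by their universal property, so it equals that morphism.\<close>

lemma Q_copy_map_hom:
  assumes e: "relabelling e" and A: "p_multiring A T" and B: "p_multiring B P"
    and f: "f \<in> p_hom A T B P"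
  shows "Q_copy_map e (A, T) (B, P) f \<in> multi_hom (Q_copy_ob e (A, T)) (Q_copy_ob e (B, P))"
    and "a \<in> carrier A \<Longrightarrow> Q_copy_map e (A, T) (B, P) f (compose (carrier A) (e A T) (proj A T) a) =
      compose (carrier B) (e B P) (proj B P) (f a)"
proof -
  let ?\<eta>A = "compose (carrier A) (e A T) (proj A T)" and ?\<eta>B = "compose (carrier B) (e B P) (proj B P)"
  interpret QA: reduction A T "Q A T" "proj A T" by (rule reduction_proj[OF A])
  interpret CA: reduction A T "Q_copy_ob e (A, T)" ?\<eta>A by (rule Q_copy_reduction[OF e A])
  have inj: "inj_on (e A T) (carrier (Q A T))" using e A by (simp add: relabelling_def)
  have fB: "f a \<in> carrier B" if "a \<in> carrier A" for a
    using f that multi_hom_closed[of f A B a] by (simp add: p_hom_def)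
  have nat: "Q_copy_map e (A, T) (B, P) f (?\<eta>A a) = ?\<eta>B (f a)" if a: "a \<in> carrier A" for a
    using a fB[OF a] QA.q_closed[OF a] inj
    by (simp add: Q_copy_map_def compose_apply Q_map_hom(2)[OF A B f])
  then show "a \<in> carrier A \<Longrightarrow> Q_copy_map e (A, T) (B, P) f (?\<eta>A a) = ?\<eta>B (f a)" .
  obtain g where g: "g \<in> multi_hom (Q_copy_ob e (A, T)) (Q_copy_ob e (B, P))"
    "compose (carrier A) g ?\<eta>A = compose (carrier A) ?\<eta>B f"
    using reduction_map_ex1[OF Q_copy_reduction[OF e A] Q_copy_reduction[OF e B] f] by blast
  have carr: "carrier (Q_copy_ob e (A, T)) = e A T ` carrier (Q A T)"
    by (simp add: Q_copy_ob_def copy_def Let_def)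
  have "Q_copy_map e (A, T) (B, P) f = g"
  proof (rule extensionalityI[where A = "carrier (Q_copy_ob e (A, T))"])
    show "Q_copy_map e (A, T) (B, P) f \<in> extensional (carrier (Q_copy_ob e (A, T)))"
      by (simp add: Q_copy_map_def carr)
    show "g \<in> extensional (carrier (Q_copy_ob e (A, T)))" by (rule multi_hom_extensional[OF g(1)])
    fix x assume "x \<in> carrier (Q_copy_ob e (A, T))"
    then obtain a where a: "a \<in> carrier A" "x = ?\<eta>A a" by (rule CA.representative)
    have "g (?\<eta>A a) = ?\<eta>B (f a)" using g(2) a(1) unfolding compose_eq_iff by blast
    then show "Q_copy_map e (A, T) (B, P) f x = g x" using nat a by simp
  qed
  then show "Q_copy_map e (A, T) (B, P) f \<in> multi_hom (Q_copy_ob e (A, T)) (Q_copy_ob e (B, P))"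
    using g(1) by simp
qed

theorem theorem1p22:
  shows
   "(\<forall>(A :: 'a multiring) T (B :: 'b multiring) P f.
       p_multiring A T \<longrightarrow> p_multiring B P \<longrightarrow> f \<in> p_hom A T B P \<longrightarrow>
       (\<exists>!g. g \<in> multi_hom (Q A T) (Q B P) \<and>
          compose (carrier A) g (proj A T) = compose (carrier A) (proj B P) f))
    \<and> cat_functor (pMulti :: ('a multiring \<times> 'a set, 'a \<Rightarrow> 'a) cat)
        (RRM :: ((('a \<Rightarrow> int) \<Rightarrow> int) multiring, (('a \<Rightarrow> int) \<Rightarrow> int) \<Rightarrow> (('a \<Rightarrow> int) \<Rightarrow> int)) cat)
        Q_fun_ob Q_fun_map
    \<and> (\<forall>(A :: 'a multiring) T (R :: 'r multiring) f.
       p_multiring A T \<longrightarrow> real_reduced R \<longrightarrow> f \<in> p_hom A T R (sum_squares R) \<longrightarrow>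
       (\<exists>!g. g \<in> multi_hom (Q A T) R \<and> compose (carrier A) g (proj A T) = f))
    \<and> (\<forall>(A :: 'a multiring) T (R :: 'r multiring).
       p_multiring A T \<longrightarrow> real_reduced R \<longrightarrow>
       bij_betw (\<lambda>g. compose (carrier A) g (proj A T))
         (multi_hom (Q A T) R) (p_hom A T R (sum_squares R)))
    \<and> (\<forall>(A :: 'a multiring) T (A' :: 'b multiring) T' (R :: 'r multiring) (R' :: 's multiring) u v g.
       p_multiring A T \<longrightarrow> p_multiring A' T' \<longrightarrow> real_reduced R \<longrightarrow> real_reduced R' \<longrightarrow>
       u \<in> p_hom A' T' A T \<longrightarrow> v \<in> multi_hom R R' \<longrightarrow> g \<in> multi_hom (Q A T) R \<longrightarrow>
       compose (carrier A')
         (compose (carrier (Q A' T')) v (compose (carrier (Q A' T')) g (Q_map A' T' A T u)))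
         (proj A' T')
       = compose (carrier A') v (compose (carrier A') (compose (carrier A) g (proj A T)) u))
    \<and> (\<forall>e :: 'a multiring \<Rightarrow> 'a set \<Rightarrow> (('a \<Rightarrow> int) \<Rightarrow> int) \<Rightarrow> 'a. relabelling e \<longrightarrow>
       left_adjoint pMulti RRM (Q_copy_ob e) (Q_copy_map e) incl_ob incl_map)"
proof (intro conjI allI impI)
  show "\<exists>!g. g \<in> multi_hom (Q A T) (Q B P) \<and>
      compose (carrier A) g (proj A T) = compose (carrier A) (proj B P) f"
    if "p_multiring A T" "p_multiring B P" "f \<in> p_hom A T B P"
    for A :: "'a multiring" and T and B :: "'b multiring" and P f
    by (rule reduction_map_ex1[OF reduction_proj reduction_proj]) fact+
  show "cat_functor (pMulti :: ('a multiring \<times> 'a set, 'a \<Rightarrow> 'a) cat) RRM Q_fun_ob Q_fun_map"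
    by (rule reduction_functor[where \<eta> = proj])
      (simp_all add: Q_fun_ob_def Q_fun_map_def reduction_proj Q_map_hom)
  show "\<exists>!g. g \<in> multi_hom (Q A T) R \<and> compose (carrier A) g (proj A T) = f"
    if "p_multiring A T" "real_reduced R" "f \<in> p_hom A T R (sum_squares R)"
    for A :: "'a multiring" and T and R :: "'r multiring" and f
    by (rule reduction.real_reduced_universal[OF reduction_proj]) fact+
  show "bij_betw (\<lambda>g. compose (carrier A) g (proj A T))
      (multi_hom (Q A T) R) (p_hom A T R (sum_squares R))"
    if "p_multiring A T" "real_reduced R" for A :: "'a multiring" and T and R :: "'r multiring"
    by (rule reduction.universal_bij[OF reduction_proj]) fact+
  show "compose (carrier A')
      (compose (carrier (Q A' T')) v (compose (carrier (Q A' T')) g (Q_map A' T' A T u)))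
      (proj A' T')
    = compose (carrier A') v (compose (carrier A') (compose (carrier A) g (proj A T)) u)"
    if A: "p_multiring A T" "p_multiring A' T'" and u: "u \<in> p_hom A' T' A T"
    for A :: "'a multiring" and T and A' :: "'b multiring" and T'
      and R :: "'r multiring" and R' :: "'s multiring" and u v g
  proof -
    interpret reduction A' T' "Q A' T'" "proj A' T'" by (rule reduction_proj[OF A(2)])
    have "u a \<in> carrier A" if "a \<in> carrier A'" for a
      using u that multi_hom_closed[of u A' A a] by (simp add: p_hom_def)
    then show ?thesis
      by (simp add: compose_eq_iff compose_apply Q_map_hom(2)[OF A(2,1) u])
  qed
  show "left_adjoint pMulti RRM (Q_copy_ob e) (Q_copy_map e) incl_ob incl_map"
    if "relabelling e" for e :: "'a multiring \<Rightarrow> 'a set \<Rightarrow> (('a \<Rightarrow> int) \<Rightarrow> int) \<Rightarrow> 'a"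
    by (rule reduction_left_adjoint[OF Q_copy_reduction[OF that] Q_copy_map_hom[OF that]])
qed

end
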